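(* Let $N\ge 2$, let $A\in\mathbb{R}^{n\times n}$, $B\in\mathbb{R}^{n\times 1}$, $C\in\mathbb{R}^{n\times l}$, and let $g\in\mathbb{R}^l$ be a vector such that $g^{\mathrm T}\chi(s)=g^{\mathrm T}C^{\mathrm T}(sI_n-A)^{-1}B$ is hyper-minimum-phase. Let $\mathcal G$ be a unit weighted digraph on $N$ vertices, without self-loops, having at least one directed spanning tree, and let $L$ be its Laplace matrix. Consider the network $$\dot x_i(t)=Ax_i(t)+Bu_i(t),\qquad y_i(t)=C^{\mathrm T}x_i(t),\qquad i=1,\dots,N,$$ with the controller $$u_i(t)=-k_i\,g^{\mathrm T}\,\overline y_i(t),\qquad \overline y_i(t)=\sum_{j\in\mathcal N_i}(y_i(t)-y_j(t)),\qquad i=1,\dots,N,$$ where $k_i=k\cdot k_i'$ with $k>0$ and $k_i'>0$ for $i=1,\dots,N$. Let $K'=\mathrm{diag}(k_1',\dots,k_N')$. If $$\sum_{i=1}^N(k_i')^2=1\qquad\text{and}\qquad k>\frac{\varkappa_0}{r(K'L)},$$ then for every initial condition $x(0)=\mathrm{col}(x_1(0),\dots,x_N(0))\in\mathbb{R}^{nN}$ one has $$\lim_{t\to\infty}(x_i(t)-x_j(t))=0,\qquad i,j=1,\dots,N,$$ and moreover $\lim_{t\to\infty}(x_i(t)-c(t))=0$ for $i=1,\dots,N$, where $$c(t)=\exp(At)\,(v(K'L)^{\mathrm T}\otimes I_n)\,x(0).$$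
   Context: Digraph conventions: a digraph is $\mathcal G=(\mathcal V,\mathcal E)$ with $\mathcal E\subseteq\mathcal V\times\mathcal V$ and no self-loops. In an arc $(\alpha,\beta)$ the vertex $\beta$ is called the parent (neighbour) of $\alpha$; agents are identified with vertices $1,\dots,N$ and $\mathcal N_i=\{j:(i,j)\in\mathcal E\}$ is the set of neighbours of agent $i$. A directed tree is a digraph in which all vertices except one (the root) have exactly one parent; a directed spanning tree of $\mathcal G$ is a directed tree formed by all vertices of $\mathcal G$ and some of its arcs such that there is a directed path (following arcs $(\alpha,\beta)$ from $\alpha$ to $\beta$) from every vertex to the root. Unit weighted: the adjacency matrix $\mathcal A(\mathcal G)$ has $(i,j)$ entry $1$ if $(i,j)\in\mathcal E$ and $0$ otherwise. The Laplace matrix is $L=\mathrm{diag}(\mathcal A(\mathcal G)\mathbf 1_N)-\mathcal A(\mathcal G)$, where $\mathbf 1_N$ is the all-ones vector. The matrix $K'L$ is the Laplace matrix of the same digraph with positive arc weights (weight $k_i'$ on every arc $(i,j)$). When $\mathcal G$ has a directed spanning tree, $0$ is a simple eigenvalue of $M=K'L$ and all other eigenvalues have positive real part; $r(M)=\min_{\lambda\ne 0}\mathrm{Re}\,\lambda$ over nonzero eigenvalues $\lambda$ of $M$, and $v(M)\in\mathbb{R}^N$ is the left eigenvector of $M$ for eigenvalue $0$ ($v(M)^{\mathrm T}M=0$) normalized by $v(M)^{\mathrm T}\mathbf 1_N=1$. Hyper-minimum-phase: with $\chi(s)=C^{\mathrm T}(sI_n-A)^{-1}B$, the function $g^{\mathrm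 T}\chi(s)$ is hyper-minimum-phase if its numerator (with respect to the denominator $\det(sI_n-A)$) is a Hurwitz polynomial (all roots in the open left half-plane) of degree $n-1$ with positive coefficients. The number $\varkappa_0$ is $$\varkappa_0=\sup_{\omega\in\mathbb{R}}\mathrm{Re}\left(-\big(g^{\mathrm T}\chi(\mathfrak i\omega)\big)^{-1}\right),$$ where $(g^{\mathrm T}\chi)^{-1}$ is the reciprocal rational function, evaluated at $\mathfrak i\omega$, $\mathfrak i^2=-1$. $\otimes$ is the Kronecker product; $\mathrm{col}$ denotes stacking into a column vector. *)

theory Defs
  imports "HOL-Analysis.Analysis" "HOL-Computational_Algebra.Polynomial"
begin

section \<open>Matrices\<close>

definition diag_matrix :: "'a::zero^'n \<Rightarrow> 'a^'n^'n" where
  "diag_matrix d = (\<chi> i j. if i = j then d $ i else 0)"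

abbreviation cmat :: "real^'m^'n \<Rightarrow> complex^'m^'n" where
  "cmat \<equiv> map_matrix complex_of_real"

definition kronecker :: "'a::times^'m^'n \<Rightarrow> 'a^'q^'p \<Rightarrow> 'a^('m \<times> 'q)^('n \<times> 'p)" where
  "kronecker P Q = (\<chi> r c. P $ fst r $ fst c * Q $ snd r $ snd c)"

text \<open>Block vectors: the pair \<open>(i, a)\<close> indexes component \<open>a\<close> of block \<open>i\<close>.\<close>

definition col_stack :: "('N::finite \<Rightarrow> 'a^'n) \<Rightarrow> 'a^('N \<times> 'n)" where
  "col_stack z = (\<chi> p. z (fst p) $ snd p)"

definition unblock1 :: "'a^(1 \<times> 'n) \<Rightarrow> 'a^'n" where
  "unblock1 w = (\<chi> a. w $ (1, a))"

lemma kronecker_rowvector_mult: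
  fixes v :: "real^'N" and z :: "'N \<Rightarrow> real^'n"
  shows "unblock1 (kronecker (rowvector v) (mat 1 :: real^'n^'n) *v col_stack z)
           = (\<Sum>i\<in>UNIV. v $ i *\<^sub>R z i)"
proof -
  have "(\<Sum>p\<in>UNIV. v $ fst p * (mat 1 :: real^'n^'n) $ a $ snd p * z (fst p) $ snd p)
          = (\<Sum>i\<in>UNIV. v $ i * z i $ a)" for a
  proof -
    have "(\<Sum>p\<in>UNIV. v $ fst p * (mat 1 :: real^'n^'n) $ a $ snd p * z (fst p) $ snd p)
        = (\<Sum>i\<in>UNIV. \<Sum>b\<in>UNIV. v $ i * (mat 1 :: real^'n^'n) $ a $ b * z i $ b)"
      by (simp add: sum.cartesian_product case_prod_unfold)
    also have "\<dots> = (\<Sum>i\<in>UNIV. \<Sum>b\<in>UNIV. if b = a then v $ i * z i $ b else 0)"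
      by (intro sum.cong refl) (auto simp: mat_def)
    finally show ?thesis by simp
  qed
  then show ?thesis
    by (simp add: vec_eq_iff unblock1_def kronecker_def col_stack_def rowvector_def
        matrix_vector_mult_def)
qed

text \<open>Matrix powers are iterated \<open>**\<close>: the operation \<open>^\<close> on \<open>real^'n^'n\<close> is componentwise.\<close>

definition matrix_power :: "real^'n^'n \<Rightarrow> nat \<Rightarrow> real^'n^'n" where
  "matrix_power M m = (((**) M) ^^ m) (mat 1)"

definition matrix_exp :: "real^'n^'n \<Rightarrow> real^'n^'n" where
  "matrix_exp M = (\<Sum>m. (1 / fact m) *\<^sub>R matrix_power M m)"

lemma summable_matrix_exp:
  fixes M :: "real^'n^'n"
  shows "summable (\<lambda>m. (1 / fact m) *\<^sub>R matrix_power M m)"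
proof -
  define a where "a = onorm ((*v) M)"
  have a0: "a \<ge> 0"
    unfolding a_def by (rule onorm_pos_le) simp
  have pow: "norm (matrix_power M m *v x) \<le> a ^ m * norm x" for m x
  proof (induction m)
    case 0
    then show ?case by (simp add: matrix_power_def)
  next
    case (Suc m)
    have "norm (matrix_power M (Suc m) *v x) = norm (M *v (matrix_power M m *v x))"
      by (simp add: matrix_power_def matrix_vector_mul_assoc)
    also have "\<dots> \<le> a * norm (matrix_power M m *v x)"
      unfolding a_def by (rule onorm) simp
    also have "\<dots> \<le> a * (a ^ m * norm x)"
      by (intro mult_left_mono Suc a0)
    finally show ?case by (simp add: mult.assoc)
  qed
  define c where "c = (\<Sum>i\<in>(UNIV::'n set). \<Sum>j\<in>(UNIV::'n set). (1::real))"
  have entry: "\<bar>matrix_power M m $ i $ j\<bar> \<le> a ^ m" for m i j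
    by (rule order_trans[OF matrix_component_le_onorm onorm_le[OF pow]])
  have "norm (matrix_power M m) \<le> c * a ^ m" for m
  proof -
    have "norm (matrix_power M m) \<le> (\<Sum>i\<in>UNIV. norm (matrix_power M m $ i))"
      by (simp add: norm_vec_def L2_set_le_sum)
    also have "\<dots> \<le> (\<Sum>i\<in>UNIV. \<Sum>j\<in>UNIV. \<bar>matrix_power M m $ i $ j\<bar>)"
      by (intro sum_mono norm_le_l1_cart)
    also have "\<dots> \<le> (\<Sum>i\<in>(UNIV::'n set). \<Sum>j\<in>(UNIV::'n set). a ^ m)"
      by (intro sum_mono entry)
    finally show ?thesis by (simp add: c_def)
  qed
  then have "norm ((1 / fact m) *\<^sub>R matrix_power M m) \<le> c * (inverse (fact m) * a ^ m)" for m
    by (simp add: field_simps)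
  moreover have "summable (\<lambda>m. c * (inverse (fact m) * a ^ m))"
    by (intro summable_mult summable_exp)
  ultimately show ?thesis
    by (rule summable_comparison_test'[where N = 0, rotated])
qed

section \<open>Weighted Laplacians\<close>

text \<open>
  An arc \<open>(\<alpha>, \<beta>)\<close> points from the vertex \<open>\<alpha>\<close> to its parent \<open>\<beta>\<close>, so paths lead towards the root.
  Arcs leaving the root are excluded from the tree.
\<close>

definition directed_spanning_tree :: "('N \<times> 'N) set \<Rightarrow> ('N \<times> 'N) set \<Rightarrow> 'N \<Rightarrow> bool" where
  "directed_spanning_tree E T r \<longleftrightarrow>
     T \<subseteq> E \<and> (\<forall>b. (r, b) \<notin> T) \<and> (\<forall>a. a \<noteq> r \<longrightarrow> (\<exists>!b. (a, b) \<in> T)) \<and> (\<forall>a. (a, r) \<in> T\<^sup>*)"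

definition has_directed_spanning_tree :: "('N \<times> 'N) set \<Rightarrow> bool" where
  "has_directed_spanning_tree E \<longleftrightarrow> (\<exists>T r. directed_spanning_tree E T r)"

definition adjacency_matrix :: "('N \<times> 'N) set \<Rightarrow> real^'N^'N" where
  "adjacency_matrix E = (\<chi> i j. if (i, j) \<in> E then 1 else 0)"

definition laplace_matrix :: "('N::finite \<times> 'N) set \<Rightarrow> real^'N^'N" where
  "laplace_matrix E = diag_matrix (adjacency_matrix E *v (\<chi> i. 1)) - adjacency_matrix E"

definition eigenvalues :: "real^'N^'N \<Rightarrow> complex set" where
  "eigenvalues M = {l. \<exists>z. z \<noteq> 0 \<and> cmat M *v z = l *s z}"

definition r_of :: "real^'N^'N \<Rightarrow> real" where
  "r_of M = Min (Re ` (eigenvalues M - {0}))"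

definition v_of :: "real^'N^'N \<Rightarrow> real^'N" where
  "v_of M = (THE v. v v* M = 0 \<and> v \<bullet> (\<chi> i. 1) = 1)"

section \<open>Transfer functions\<close>

definition resolvent_matrix :: "real^'n^'n \<Rightarrow> complex \<Rightarrow> complex^'n^'n" where
  "resolvent_matrix A s = matrix_inv (mat s - cmat A)"

definition transfer_fun :: "real^'n^'n \<Rightarrow> real^'n \<Rightarrow> real^'l^'n \<Rightarrow> complex \<Rightarrow> complex^'l" where
  "transfer_fun A B C s =
     cmat (transpose C) *v (resolvent_matrix A s *v (\<chi> i. complex_of_real (B $ i)))"

definition scalar_transfer ::
  "real^'n^'n \<Rightarrow> real^'n \<Rightarrow> real^'l^'n \<Rightarrow> real^'l \<Rightarrow> complex \<Rightarrow> complex" where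
  "scalar_transfer A B C g s = (\<Sum>m\<in>UNIV. complex_of_real (g $ m) * transfer_fun A B C s $ m)"

definition cpoly :: "real poly \<Rightarrow> complex \<Rightarrow> complex" where
  "cpoly p s = poly (map_poly complex_of_real p) s"

definition is_numerator ::
  "real^'n^'n \<Rightarrow> real^'n \<Rightarrow> real^'l^'n \<Rightarrow> real^'l \<Rightarrow> real poly \<Rightarrow> bool" where
  "is_numerator A B C g p \<longleftrightarrow>
     (\<forall>s. det (mat s - cmat A) \<noteq> 0 \<longrightarrow>
        scalar_transfer A B C g s = cpoly p s / det (mat s - cmat A))"

definition numerator :: "real^'n^'n \<Rightarrow> real^'n \<Rightarrow> real^'l^'n \<Rightarrow> real^'l \<Rightarrow> real poly" where
  "numerator A B C g = (THE p. is_numerator A B C g p)"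

lemma cpoly_add: "cpoly (p + q) s = cpoly p s + cpoly q s"
proof -
  have "map_poly complex_of_real (p + q) = map_poly complex_of_real p + map_poly complex_of_real q"
    by (intro poly_eqI) (simp add: coeff_map_poly)
  then show ?thesis by (simp add: cpoly_def)
qed

lemma cpoly_pCons: "cpoly (pCons a p) s = of_real a + s * cpoly p s"
  by (simp add: cpoly_def map_poly_pCons)

lemma cpoly_0 [simp]: "cpoly 0 s = 0"
  by (simp add: cpoly_def)

lemma cpoly_1: "cpoly 1 s = 1"
  by (simp add: cpoly_def)

lemma cpoly_smult: "cpoly (smult a p) s = of_real a * cpoly p s"
  by (simp add: cpoly_def map_poly_smult)

lemma cpoly_mult: "cpoly (p * q) s = cpoly p s * cpoly q s"
  by (induction p) (simp_all add: cpoly_add cpoly_pCons cpoly_smult algebra_simps)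

lemma cpoly_sum: "cpoly (sum f S) s = (\<Sum>x\<in>S. cpoly (f x) s)"
  by (induction S rule: infinite_finite_induct) (simp_all add: cpoly_add)

lemma cpoly_prod: "cpoly (prod f S) s = (\<Prod>x\<in>S. cpoly (f x) s)"
  by (induction S rule: infinite_finite_induct) (simp_all add: cpoly_mult cpoly_1)

lemma cpoly_of_int: "cpoly (of_int z) s = of_int z"
  by (simp add: cpoly_def of_int_poly map_poly_pCons)

lemma cpoly_det: "cpoly (det P) s = det (map_matrix (\<lambda>p. cpoly p s) P)"
  by (simp add: det_def cpoly_sum cpoly_mult cpoly_prod cpoly_of_int)

lemma ex_numerator: "\<exists>p. is_numerator A B C g p"
proof -
  define h where "h = (\<lambda>k. \<Sum>m\<in>UNIV. g $ m * C $ k $ m)"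
  define P where "P = (\<lambda>k. \<chi> i j. if j = k then [:B $ i:]
      else [:- A $ i $ j, if i = j then 1 else 0:])"
  define p where "p = (\<Sum>k\<in>UNIV. smult (h k) (det (P k)))"
  have "scalar_transfer A B C g s = cpoly p s / det (mat s - cmat A)"
    if nz: "det (mat s - cmat A) \<noteq> 0" for s
  proof -
    define S where "S = mat s - cmat A"
    define b where "b = (\<chi> i. complex_of_real (B $ i))"
    have "invertible S"
      using nz by (simp add: S_def invertible_det_nz)
    then have "S ** matrix_inv S = mat 1"
      unfolding invertible_def matrix_inv_def by (rule someI2_ex) simp
    then have "S *v (matrix_inv S *v b) = b"
      by (simp add: matrix_vector_mul_assoc)
    then have "matrix_inv S *v b = (\<chi> k. det (\<chi> i j. if j = k then b $ i else S $ i $ j) / det S)"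
      using nz by (subst (asm) cramer) (auto simp: S_def)
    moreover have "cpoly (det (P k)) s = det (\<chi> i j. if j = k then b $ i else S $ i $ j)" for k
      unfolding cpoly_det
      by (rule arg_cong[of _ _ det])
         (auto simp: vec_eq_iff P_def b_def S_def cpoly_pCons mat_def)
    ultimately have x: "(matrix_inv S *v b) $ k = cpoly (det (P k)) s / det S" for k
      by simp
    have "scalar_transfer A B C g s
        = (\<Sum>m\<in>UNIV. \<Sum>k\<in>UNIV. of_real (g $ m * C $ k $ m) * (matrix_inv S *v b) $ k)"
      unfolding scalar_transfer_def transfer_fun_def resolvent_matrix_def
        S_def[symmetric] b_def[symmetric]
      by (simp only: matrix_vector_mult_def[of "cmat (transpose C)"])
         (simp add: sum_distrib_left transpose_def mult.assoc)
    also have "\<dots> = (\<Sum>k\<in>UNIV. of_real (h k) * (matrix_inv S *v b) $ k)"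
      by (subst sum.swap) (simp add: h_def sum_distrib_right)
    also have "\<dots> = cpoly p s / det S"
      by (simp add: x p_def cpoly_sum cpoly_smult sum_divide_distrib)
    finally show ?thesis by (simp add: S_def)
  qed
  then show ?thesis
    unfolding is_numerator_def by blast
qed

lemma det_resolvent_nonzero_large:
  fixes A :: "real^'n^'n"
  obtains K where "\<And>s. norm s > K \<Longrightarrow> det (mat s - cmat A) \<noteq> 0"
proof -
  obtain K where K: "\<And>x. norm (cmat A *v x) \<le> norm x * K"
    using bounded_linear.bounded[OF matrix_vector_mul_bounded_linear, of "cmat A"] by blast
  have "det (mat s - cmat A) \<noteq> 0" if s: "norm s > K" for s
  proof
    assume "det (mat s - cmat A) = 0"
    then have "\<not> invertible (mat s - cmat A)"
      by (simp add: invertible_det_nz)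
    then obtain x where x: "x \<noteq> 0" "(mat s - cmat A) *v x = 0"
      by (auto simp: invertible_left_inverse matrix_left_invertible_ker)
    then have "s *s x = cmat A *v x"
      by (simp add: matrix_vector_mult_diff_rdistrib)
         (simp add: vec_eq_iff matrix_vector_mult_def mat_def if_distrib[of "\<lambda>c. c * _"] cong: if_cong)
    moreover have "norm (s *s x) = norm s * norm x"
      by (simp add: norm_vec_def norm_mult L2_set_right_distrib)
    ultimately have "norm s * norm x \<le> norm x * K"
      using K[of x] by simp
    with s x(1) show False
      by (simp add: mult.commute)
  qed
  then show thesis by (rule that)
qed

lemma ex1_numerator: "\<exists>!p. is_numerator A B C g p"
proof (rule ex_ex1I[OF ex_numerator])
  fix p q
  assume pq: "is_numerator A B C g p" "is_numerator A B C g q"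
  obtain K where K: "\<And>s. norm s > K \<Longrightarrow> det (mat s - cmat A) \<noteq> 0"
    using det_resolvent_nonzero_large by blast
  define P where "P = map_poly complex_of_real p"
  define Q where "Q = map_poly complex_of_real q"
  have "poly (P - Q) s = 0" if "norm s > K" for s
    using pq K[OF that] by (fastforce simp: is_numerator_def cpoly_def P_def Q_def)
  moreover have "infinite {s::complex. norm s > K}"
  proof
    assume "finite {s::complex. norm s > K}"
    then have "finite (complex_of_real ` {\<bar>K\<bar><..})"
      by (rule finite_subset[rotated]) auto
    then show False
      by (simp add: finite_image_iff inj_on_def infinite_Ioi)
  qed
  ultimately have "infinite {s. poly (P - Q) s = 0}"
    using finite_subset[of "{s. norm s > K}" "{s. poly (P - Q) s = 0}"] by auto
  then have "P = Q"
    using poly_roots_finite[of "P - Q"] by auto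
  then have "complex_of_real (coeff p m) = complex_of_real (coeff q m)" for m
    using coeff_map_poly[of complex_of_real p m] coeff_map_poly[of complex_of_real q m]
    by (simp add: P_def Q_def)
  then show "p = q"
    by (simp add: poly_eq_iff)
qed

definition hyper_minimum_phase ::
  "real^'n^'n \<Rightarrow> real^'n \<Rightarrow> real^'l^'n \<Rightarrow> real^'l \<Rightarrow> bool" where
  "hyper_minimum_phase A B C g \<longleftrightarrow>
     (let p = numerator A B C g in
        degree p = CARD('n) - 1 \<and>
        (\<forall>m\<le>degree p. coeff p m > 0) \<and>
        (\<forall>s. cpoly p s = 0 \<longrightarrow> Re s < 0))"

text \<open>
  The reciprocal is taken as a rational function: poles of the transfer function are zeros of it,
  whereas the pointwise \<open>inverse (scalar_transfer A B C g s)\<close> is arbitrary where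
  \<open>det (mat s - cmat A) = 0\<close>. For a Hurwitz numerator the quotient is defined on the whole
  imaginary axis.
\<close>

definition reciprocal_transfer ::
  "real^'n^'n \<Rightarrow> real^'n \<Rightarrow> real^'l^'n \<Rightarrow> real^'l \<Rightarrow> complex \<Rightarrow> complex" where
  "reciprocal_transfer A B C g s = det (mat s - cmat A) / cpoly (numerator A B C g) s"

definition kappa0 :: "real^'n^'n \<Rightarrow> real^'n \<Rightarrow> real^'l^'n \<Rightarrow> real^'l \<Rightarrow> real" where
  "kappa0 A B C g = (SUP \<omega>. Re (- reciprocal_transfer A B C g (\<i> * complex_of_real \<omega>)))"

end

theory Submission
  imports "HOL-Complex_Analysis.Conformal_Mappings"
    "HOL-Computational_Algebra.Fundamental_Theorem_Algebra"
    "HOL-Real_Asymp.Real_Asymp"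
    Defs
begin

text \<open>
  Write \<open>M = K' L\<close>, \<open>h = C g\<close>, and for \<open>a \<in> \<complex>\<^sup>N\<close>, \<open>b \<in> \<complex>\<^sup>n\<close> put
  \<open>\<eta> a b = \<Sum>\<^sub>i a\<^sub>i (b \<cdot> x\<^sub>i)\<close>. Along solutions
  \<open>(\<eta> a b)' = \<eta> a (A\<^sup>T b) - k (b \<cdot> B) \<eta> (M\<^sup>T a) h\<close>. Hence, if \<open>\<eta> (M\<^sup>T a - \<lambda> a) b\<close> vanishes at
  infinity for all \<open>b\<close>, the mode \<open>a\<close> is governed by \<open>A - k \<lambda> B h\<^sup>T\<close> up to a vanishing
  perturbation. The characteristic polynomial of this matrix is \<open>\<alpha> + k \<lambda> p\<close> with \<open>\<alpha>\<close> that of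
  \<open>A\<close> and \<open>p\<close> the numerator of the transfer function. By the maximum principle
  \<open>Re (- \<alpha> / p) \<le> \<kappa>\<^sub>0\<close> extends from the imaginary axis to the right half-plane, while
  \<open>Re (k \<lambda>) > \<kappa>\<^sub>0\<close> for every nonzero eigenvalue \<open>\<lambda>\<close> of \<open>M\<close>; so the matrix is Hurwitz. Climbing
  the generalized eigenvectors of \<open>M\<^sup>T\<close> in the space \<open>\<Sum>\<^sub>i a\<^sub>i = 0\<close>, on which \<open>M\<^sup>T\<close> is injective,
  gives \<open>\<eta> a b \<longlonglongrightarrow> 0\<close> there, in particular for \<open>a = e\<^sub>i - v\<close>. Finally \<open>\<Sum>\<^sub>i v\<^sub>i x\<^sub>i\<close> solves
  \<open>z' = A z\<close>.
\<close>

section \<open>Generalized eigenvectors and perturbed scalar equations\<close>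

text \<open>The vector p(T) a, evaluated by Horner's scheme on vectors; no matrix powers are formed,
  since \<open>^\<close> acts on matrices componentwise.\<close>

definition matrix_poly_apply :: "complex poly \<Rightarrow> complex^'n^'n \<Rightarrow> complex^'n \<Rightarrow> complex^'n" where
  "matrix_poly_apply p T a = fold_coeffs (\<lambda>c w. c *s a + T *v w) p 0"

lemma matrix_poly_apply_0 [simp]: "matrix_poly_apply 0 T a = 0"
  by (simp add: matrix_poly_apply_def)

lemma matrix_poly_apply_pCons [simp]:
  "matrix_poly_apply (pCons c p) T a = c *s a + T *v matrix_poly_apply p T a"
proof (cases "p = 0 \<and> c = 0")
  case False
  then show ?thesis
    by (cases "p = 0") (simp_all add: matrix_poly_apply_def)
qed simp

lemma matrix_poly_apply_add:
  "matrix_poly_apply (p + q) T a = matrix_poly_apply p T a + matrix_poly_apply q T a"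
  by (induction p q rule: poly_induct2)
     (simp_all add: vec.scale_left_distrib matrix_vector_right_distrib algebra_simps)

lemma matrix_poly_apply_smult:
  "matrix_poly_apply (smult c p) T a = c *s matrix_poly_apply p T a"
  by (induction p)
     (simp_all add: vec.scale_right_distrib vector_scalar_commute)

lemma matrix_poly_apply_linear_factor:
  "matrix_poly_apply ([:- s, 1:] * q) T a
     = T *v matrix_poly_apply q T a - s *s matrix_poly_apply q T a"
proof -
  have "[:- s, 1:] * q = pCons 0 q + smult (- s) q"
    by simp
  then show ?thesis
    by (simp only: matrix_poly_apply_add matrix_poly_apply_smult) (simp add: vec.scale_minus_left)
qed

text \<open>Polynomials in \<open>T\<close> commute with T - s. Combined with
  \<open>matrix_poly_apply_linear_factor\<close>: if (X - s) q annihilates \<open>a\<close>, then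
  \<open>q\<close> annihilates T a - s a.\<close>

lemma matrix_poly_apply_commute:
  "matrix_poly_apply q T (T *v a - s *s a)
     = T *v matrix_poly_apply q T a - s *s matrix_poly_apply q T a"
  by (induction q)
     (simp_all add: matrix_vector_right_distrib matrix_vector_mult_diff_distrib vec.scale_right_distrib
        vec.scale_right_diff_distrib vector_scalar_commute mult.commute)

lemma matrix_poly_apply_sum:
  "matrix_poly_apply (\<Sum>i\<in>I. p i) T a = (\<Sum>i\<in>I. matrix_poly_apply (p i) T a)"
  by (induction I rule: infinite_finite_induct) (simp_all add: matrix_poly_apply_add)

lemma matrix_poly_apply_monom:
  "matrix_poly_apply (monom c i) T a = c *s ((*v) T ^^ i) a"
  by (induction i) (simp_all add: monom_0 monom_Suc vec.scale)

lemma matrix_poly_apply_mem: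
  assumes "vec.subspace W" "\<And>b. b \<in> W \<Longrightarrow> T *v b \<in> W" "a \<in> W"
  shows "matrix_poly_apply p T a \<in> W"
  by (induction p) (auto intro!: vec.subspace_add vec.subspace_scale vec.subspace_0 assms)

text \<open>The n + 1 vectors a, T a, ..., T^n a lie in a space of dimension n, and a linear
  relation among them is an annihilating polynomial.\<close>

lemma ex_annihilating_poly:
  fixes T :: "complex^'n^'n"
  obtains p where "p \<noteq> 0" "matrix_poly_apply p T a = 0"
proof -
  define f where "f i = ((*v) T ^^ i) a" for i
  define n where "n = vec.dim (UNIV :: (complex^'n) set)"
  show thesis
  proof (cases "inj_on f {..n}")
    \<comment> \<open>A repeated iterate is invisible to dependence of the set of iterates, so it is
      treated apart, by X^i - X^j.\<close>
    case False
    then obtain i j where ij: "i \<noteq> j" "f i = f j"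
      by (auto simp: inj_on_def)
    have "monom 1 i + smult (-1) (monom 1 j) \<noteq> (0 :: complex poly)"
      using ij(1) by (auto simp: poly_eq_iff dest!: spec[of _ i])
    moreover have "matrix_poly_apply (monom 1 i + smult (-1) (monom 1 j)) T a = 0"
      using ij(2) unfolding matrix_poly_apply_add matrix_poly_apply_smult matrix_poly_apply_monom
      by (simp add: f_def vec.scale_minus_left)
    ultimately show thesis by (rule that)
  next
    case True
    have "vec.dependent (f ` {..n})"
    proof (rule vec.dependent_biggerset_general)
      have "vec.dim (f ` {..n}) \<le> n"
        unfolding n_def by (rule vec.dim_subset) simp
      then show "vec.dim (f ` {..n}) < card (f ` {..n})"
        using True by (simp add: card_image)
    qed
    then obtain u v where u: "v \<in> f ` {..n}" "u v \<noteq> 0" "(\<Sum>v\<in>f ` {..n}. u v *s v) = 0"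
      by (auto simp: vec.dependent_finite)
    define p where "p = (\<Sum>i\<le>n. monom (u (f i)) i)"
    obtain i where i: "i \<le> n" "v = f i"
      using u(1) by auto
    have "coeff p i = u (f i)"
      using i(1) by (simp add: p_def coeff_sum)
    then have "p \<noteq> 0"
      using u(2) i(2) by auto
    moreover have "matrix_poly_apply p T a = 0"
      using u(3) unfolding sum.reindex[OF True]
      by (simp add: p_def matrix_poly_apply_sum matrix_poly_apply_monom f_def)
    ultimately show thesis by (rule that)
  qed
qed

text \<open>Induction on the degree of an annihilating polynomial p = (X - s) q of \<open>b\<close>.
  Either \<open>q\<close> already annihilates \<open>b\<close>, or z = q(T) b is an eigenvector for
  \<open>s\<close> in \<open>W\<close> and \<open>q\<close> annihilates T b - s b. This replaces
  Jordan chains and does not ask \<open>P\<close> to be closed under sums; \<open>z\<close> only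
  certifies that \<open>s\<close> is an eigenvalue of \<open>T\<close> on \<open>W\<close>.\<close>

lemma generalized_eigenvector_induct:
  fixes T :: "complex^'n^'n"
  assumes W: "vec.subspace W" "\<And>b. b \<in> W \<Longrightarrow> T *v b \<in> W"
    and "a \<in> W" "P 0"
    and step: "\<And>b s z. b \<in> W \<Longrightarrow> z \<in> W \<Longrightarrow> z \<noteq> 0 \<Longrightarrow> T *v z = s *s z \<Longrightarrow> P (T *v b - s *s b) \<Longrightarrow> P b"
  shows "P a"
proof -
  have "P b" if "p \<noteq> 0" "b \<in> W" "matrix_poly_apply p T b = 0" for p b
    using that
  proof (induction "degree p" arbitrary: p b)
    case 0
    then obtain c where "p = [:c:]" "c \<noteq> 0"
      by (metis degree_eq_zeroE pCons_0_0)
    with 0 have "b = 0" by simp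
    with \<open>P 0\<close> show ?case by simp
  next
    case (Suc m)
    obtain s where "poly p s = 0"
      using Suc.hyps(2) alg_closed_imp_poly_has_root[of p] by auto
    then obtain q where q: "p = [:- s, 1:] * q"
      by (metis poly_eq_0_iff_dvd dvdE)
    with Suc.prems(1) have "q \<noteq> 0" by auto
    then have "degree p = Suc (degree q)"
      unfolding q by (subst degree_mult_eq) auto
    with Suc.hyps(2) have deg: "m = degree q" by simp
    define z where "z = matrix_poly_apply q T b"
    have z: "T *v z = s *s z" "z \<in> W"
      using Suc.prems W matrix_poly_apply_mem[OF W Suc.prems(2)]
      by (simp_all add: z_def q matrix_poly_apply_linear_factor del: mult_pCons_left)
    show ?case
    proof (cases "z = 0")
      case True
      then show ?thesis
        using Suc.hyps(1)[OF deg \<open>q \<noteq> 0\<close>] Suc.prems(2) by (simp add: z_def)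
    next
      case False
      have "matrix_poly_apply q T (T *v b - s *s b) = 0"
        using z(1) by (simp add: matrix_poly_apply_commute z_def)
      moreover have "T *v b - s *s b \<in> W"
        using Suc.prems(2) by (intro vec.subspace_diff vec.subspace_scale W)
      ultimately have "P (T *v b - s *s b)"
        using Suc.hyps(1)[OF deg \<open>q \<noteq> 0\<close>] by blast
      with step Suc.prems(2) False z show ?thesis by blast
    qed
  qed
  with ex_annihilating_poly[of T a] \<open>a \<in> W\<close> show ?thesis by metis
qed

text \<open>The integrating factor exp (-s t) removes the linear term. Past \<open>N\<close> the
  derivative of \<open>W\<close> is bounded by d exp (m t), so comparison with (d / m) exp (m t) and
  multiplication by exp (-m t) bound |w| by K exp (-m t) + d / m.\<close>

lemma scalar_ode_tendsto_0:
  fixes f w :: "real \<Rightarrow> complex"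
  assumes ode: "\<And>t. t \<ge> 0 \<Longrightarrow> (w has_vector_derivative s * w t + f t) (at t within {0..})"
    and f: "(f \<longlongrightarrow> 0) at_top" and s: "Re s < 0"
  shows "(w \<longlongrightarrow> 0) at_top"
proof (rule tendstoI)
  fix e :: real assume e: "e > 0"
  define m where "m = - Re s"
  have m: "m > 0" using s by (simp add: m_def)
  \<comment> \<open>Chosen so that the forcing contributes d / m = e / 2 to the final bound.\<close>
  define d where "d = e * m / 2"
  have d: "d > 0" using e m by (simp add: d_def)
  obtain N0 where "\<And>t. t \<ge> N0 \<Longrightarrow> norm (f t) < d"
    using tendstoD[OF f d] by (auto simp: eventually_at_top_linorder)
  then obtain N where N: "N \<ge> 0" "\<And>t. t \<ge> N \<Longrightarrow> norm (f t) \<le> d"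
    by (metis max.cobounded1 max.cobounded2 less_imp_le order_trans)
  define W where "W t = exp (- of_real t * s) * w t" for t
  have der: "(w has_vector_derivative s * w t + f t) (at t)" if "t > 0" for t
  proof -
    have "at t within {0..} = at t"
      using that by (intro at_within_interior) (simp add: interior_real_atLeast)
    with ode[of t] that show ?thesis by simp
  qed
  have Wder: "(W has_vector_derivative exp (- of_real t * s) * f t) (at t)" if "t > 0" for t
  proof -
    have "((\<lambda>t. exp (- of_real t * s)) has_vector_derivative - s * exp (- of_real t * s)) (at t)"
      by (intro has_vector_derivative_real_field derivative_eq_intros) auto
    from has_vector_derivative_mult[OF this der[OF that]] show ?thesis
      unfolding W_def by (simp add: algebra_simps)
  qed
  have bound: "norm (W t - W N) \<le> d / m * exp (m * t) - d / m * exp (m * N)" if t: "t > N" for t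
  proof (rule differentiable_bound_general[OF t])
    have "continuous_on {0..} w"
      unfolding continuous_on_eq_continuous_within
      using has_vector_derivative_continuous[OF ode] by auto
    then have "continuous_on {N..t} w"
      by (rule continuous_on_subset) (use N in auto)
    then show "continuous_on {N..t} W"
      unfolding W_def by (intro continuous_intros)
    show "continuous_on {N..t} (\<lambda>t. d / m * exp (m * t))"
      by (intro continuous_intros)
    show "(W has_vector_derivative exp (- of_real x * s) * f x) (at x)" if "N < x" for x
      using Wder that N by simp
    show "((\<lambda>t. d / m * exp (m * t)) has_vector_derivative d * exp (m * x)) (at x)" for x
      unfolding has_real_derivative_iff_has_vector_derivative[symmetric]
      using m by (auto intro!: derivative_eq_intros)
    show "norm (exp (- of_real x * s) * f x) \<le> d * exp (m * x)" if "N < x" for x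
      using N(2)[of x] that by (simp add: norm_mult m_def mult.commute)
  qed
  define K where "K = norm (W N)"
  have w: "norm (w t) \<le> K * exp (- m * t) + e / 2" if t: "t > N" for t
  proof -
    have "norm (W t) \<le> K + d / m * exp (m * t)"
      using bound[OF t] norm_triangle_ineq2[of "W t" "W N"] m d
      by (smt (verit) K_def divide_nonneg_nonneg exp_ge_zero mult_nonneg_nonneg)
    moreover have "norm (W t) = exp (m * t) * norm (w t)"
      by (simp add: W_def norm_mult m_def mult.commute)
    ultimately have "exp (m * t) * norm (w t) \<le> exp (m * t) * (K * exp (- m * t) + d / m)"
      by (simp add: ring_distribs exp_minus mult.left_commute[of _ K] mult.commute[of d])
    then have "norm (w t) \<le> K * exp (- m * t) + d / m"
      by (rule mult_left_le_imp_le) simp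
    then show ?thesis
      using m by (simp add: d_def)
  qed
  have "((\<lambda>t. K * exp (- m * t)) \<longlongrightarrow> 0) at_top"
    using m by real_asymp
  then have "\<forall>\<^sub>F t in at_top. K * exp (- m * t) < e / 2"
    by (rule order_tendstoD(2)) (use e in simp)
  with eventually_gt_at_top[of N] show "\<forall>\<^sub>F t in at_top. dist (w t) 0 < e"
    by eventually_elim (use w in \<open>fastforce simp: dist_norm\<close>)
qed

section \<open>Closed-loop determinant and transfer function\<close>

text \<open>Induction on the set \<open>J\<close> of perturbed rows by linearity in row
  \<open>k\<close>; \<open>S\<close> stays arbitrary because the induction hypothesis is also
  applied to \<open>S\<close> with row \<open>k\<close> replaced by \<open>h\<close>.\<close>

lemma det_add_rank_one_rows:
  fixes S :: "'a::comm_ring_1^'n^'n" and h :: "'a^'n"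
  assumes "finite J"
  shows "det (\<chi> i. S $ i + (if i \<in> J then b i *s h else 0))
      = det S + (\<Sum>k\<in>J. b k * det (\<chi> i. if i = k then h else S $ i))"
  using assms
proof (induction J arbitrary: S)
  case empty
  then show ?case by (simp add: vec_lambda_eta)
next
  case (insert k J)
  let ?S = "\<chi> i. if i = k then h else S $ i"
  let ?c = "\<lambda>i. S $ i + (if i \<in> J then b i *s h else 0)"
  \<comment> \<open>Rows \<open>j\<close> and \<open>k\<close> both equal \<open>h\<close>, so the
    terms of second order in \<open>b\<close> vanish.\<close>
  have 0: "det (\<chi> i. if i = j then h else ?S $ i) = 0" if "j \<in> J" for j
    by (rule det_identical_rows[of j k])
       (use that insert.hyps in \<open>auto simp: row_def\<close>)
  have "det (\<chi> i. S $ i + (if i \<in> insert k J then b i *s h else 0))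
      = det (\<chi> i. if i = k then S $ i + b i *s h else ?c i)"
    by (rule arg_cong[of _ _ det]) (auto simp: vec_eq_iff)
  also have "\<dots> = det (\<chi> i. if i = k then S $ i else ?c i) + b k * det (\<chi> i. if i = k then h else ?c i)"
    by (subst det_row_add, subst det_row_mul[symmetric])
       (intro arg_cong2[of _ _ _ _ "(+)"] arg_cong[of _ _ det]; auto simp: vec_eq_iff)
  also have "(\<chi> i. if i = k then S $ i else ?c i) = (\<chi> i. ?c i)"
    using insert.hyps by (auto simp: vec_eq_iff)
  also have "(\<chi> i. if i = k then h else ?c i) = (\<chi> i. ?S $ i + (if i \<in> J then b i *s h else 0))"
    using insert.hyps by (auto simp: vec_eq_iff)
  finally show ?case
    using insert.hyps unfolding insert.IH by (simp add: 0 algebra_simps cong: sum.cong)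
qed

definition outer_product :: "'a::times^'n \<Rightarrow> 'a^'m \<Rightarrow> 'a^'m^'n" where
  "outer_product b h = (\<chi> i j. b $ i * h $ j)"

text \<open>A rank-one perturbation enters the determinant affinely, so the gains 0 and 1 determine
  the value at every gain \<open>m\<close>.\<close>

lemma det_add_outer_product:
  fixes S :: "'a::comm_ring_1^'n^'n"
  shows "det (S + outer_product (m *s b) h) = det S + m * (det (S + outer_product b h) - det S)"
proof -
  have *: "det (S + outer_product c h) = det S + (\<Sum>k\<in>UNIV. c $ k * det (\<chi> i. if i = k then h else S $ i))"
    for c
    unfolding det_add_rank_one_rows[OF finite, symmetric]
    by (rule arg_cong[of _ _ det]) (simp add: vec_eq_iff outer_product_def)
  show ?thesis
    unfolding * by (simp add: sum_distrib_left mult.assoc)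
qed

lemma det_mat_1_add_outer_product:
  fixes b h :: "'a::field^'n"
  shows "det (mat 1 + outer_product b h) = 1 + (\<Sum>k\<in>UNIV. h $ k * b $ k)"
proof -
  have "det (\<chi> i. if i = k then h else (mat 1 :: 'a^'n^'n) $ i) = h $ k" for k
  proof -
    have "(\<Sum>i\<in>UNIV. h $ i *s row i (mat 1 :: 'a^'n^'n)) = h"
      by (simp add: vec_eq_iff row_def mat_def if_distrib cong: if_cong)
    then show ?thesis
      using cramer_lemma_transpose[of k h "mat 1"] by (simp add: row_def vec_lambda_eta cong: if_cong)
  qed
  moreover have "det (mat 1 + outer_product b h)
      = det (mat 1 :: 'a^'n^'n) + (\<Sum>k\<in>UNIV. b $ k * det (\<chi> i. if i = k then h else (mat 1 :: 'a^'n^'n) $ i))"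
    unfolding det_add_rank_one_rows[OF finite, symmetric]
    by (rule arg_cong[of _ _ det]) (simp add: vec_eq_iff outer_product_def)
  ultimately show ?thesis
    by (simp add: mult.commute)
qed

section \<open>Characteristic polynomials and the numerator of the transfer function\<close>

definition char_polynomial :: "real^'n^'n \<Rightarrow> real poly" where
  "char_polynomial A = det (\<chi> i j. [:- A $ i $ j, if i = j then 1 else 0:])"

lemma cpoly_char_polynomial: "cpoly (char_polynomial A) s = det (mat s - cmat A)"
  unfolding char_polynomial_def cpoly_det
  by (rule arg_cong[of _ _ det]) (auto simp: vec_eq_iff cpoly_pCons mat_def)

lemma degree_le_1E:
  assumes "degree p \<le> 1"
  obtains a b where "p = [:a, b:]"
proof (cases p)
  case (pCons a q)
  with assms have "degree q = 0"
    by (cases "q = 0") auto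
  with pCons that show thesis
    by (elim degree_eq_zeroE) auto
qed

text \<open>The coefficient at \<open>card I\<close> is used instead of the leading one, so that
  constant factors are covered as well.\<close>

lemma degree_prod_coeff_prod_linear:
  fixes p :: "'b \<Rightarrow> 'a::comm_ring_1 poly"
  assumes "finite I" "\<And>i. i \<in> I \<Longrightarrow> degree (p i) \<le> 1"
  shows "degree (\<Prod>i\<in>I. p i) \<le> card I \<and> coeff (\<Prod>i\<in>I. p i) (card I) = (\<Prod>i\<in>I. coeff (p i) 1)"
  using assms
proof (induction I)
  case (insert k I)
  obtain a b where "p k = [:a, b:]"
    by (rule degree_le_1E[OF insert.prems(1)[of k]]) auto
  moreover have "coeff (\<Prod>i\<in>I. p i) (Suc (card I)) = 0"
    using insert by (intro coeff_eq_0) auto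
  moreover have "degree (p k * (\<Prod>i\<in>I. p i)) \<le> Suc (card I)"
    using insert degree_mult_le[of "p k" "\<Prod>i\<in>I. p i"] insert.prems[of k] by fastforce
  ultimately show ?case
    using insert by simp
qed simp

text \<open>In the Leibniz expansion only the identity permutation reaches the top degree.\<close>

lemma char_polynomial_monic:
  fixes A :: "real^'n^'n"
  shows "degree (char_polynomial A) = CARD('n)" "coeff (char_polynomial A) CARD('n) = 1"
proof -
  define P where "P = (\<chi> i j. [:- A $ i $ j, if i = j then 1 else 0:])"
  have deg: "degree (\<Prod>i\<in>UNIV. P $ i $ \<sigma> i) \<le> CARD('n) \<and>
      coeff (\<Prod>i\<in>UNIV. P $ i $ \<sigma> i) CARD('n) = (\<Prod>i\<in>UNIV. if i = \<sigma> i then 1 else 0)" for \<sigma> :: "'n \<Rightarrow> 'n"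
    using degree_prod_coeff_prod_linear[of UNIV "\<lambda>i. P $ i $ \<sigma> i"]
    by (simp add: P_def)
  have le: "degree (char_polynomial A) \<le> CARD('n)"
    unfolding char_polynomial_def det_def P_def[symmetric]
    by (intro degree_sum_le finite_permutations order_trans[OF degree_mult_le])
       (use deg in \<open>auto simp: degree_of_int\<close>)
  have "coeff (char_polynomial A) CARD('n)
      = (\<Sum>\<sigma> | \<sigma> permutes (UNIV :: 'n set). of_int (sign \<sigma>) * (\<Prod>i\<in>UNIV. if i = \<sigma> i then 1 else 0))"
    unfolding char_polynomial_def det_def P_def[symmetric] coeff_sum
    by (intro sum.cong refl) (simp add: of_int_poly deg)
  also have "\<dots> = (\<Sum>\<sigma> | \<sigma> permutes (UNIV :: 'n set). if \<sigma> = id then 1 else 0)"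
  proof (intro sum.cong refl)
    fix \<sigma> :: "'n \<Rightarrow> 'n"
    show "of_int (sign \<sigma>) * (\<Prod>i\<in>UNIV. if i = \<sigma> i then 1 else 0) = (if \<sigma> = id then 1 else (0::real))"
    proof (cases "\<sigma> = id")
      case False
      then obtain i where "i \<noteq> \<sigma> i"
        by (metis eq_id_iff)
      then have "(\<Prod>i\<in>UNIV. if i = \<sigma> i then 1 else 0) = (0::real)"
        by (intro prod_zero) auto
      with False show ?thesis by simp
    qed (simp add: sign_id)
  qed
  also have "\<dots> = 1"
    by (simp add: finite_permutations permutes_id)
  finally show 1: "coeff (char_polynomial A) CARD('n) = 1" .
  show "degree (char_polynomial A) = CARD('n)"
    by (intro antisym le le_degree) (simp add: 1)
qed

lemma cpoly_diff: "cpoly (p - q) s = cpoly p s - cpoly q s"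
  using cpoly_add[of "p - q" q s] by simp

definition cvec :: "real^'n \<Rightarrow> complex^'n" where
  "cvec b = (\<chi> i. complex_of_real (b $ i))"

lemma numerator_eqI: "is_numerator A B C g p \<Longrightarrow> numerator A B C g = p"
  unfolding numerator_def using ex1_numerator[of A B C g] by (rule the1_equality)

lemma scalar_transfer_eq:
  "scalar_transfer A B C g s = (\<Sum>k\<in>UNIV. cvec (C *v g) $ k * (resolvent_matrix A s *v cvec B) $ k)"
  unfolding scalar_transfer_def transfer_fun_def cvec_def
  unfolding matrix_vector_mult_def[of "cmat (transpose C)"] matrix_vector_mult_def[of C]
  by (simp add: sum_distrib_left sum_distrib_right transpose_def, subst sum.swap) (simp add: mult_ac)

text \<open>For D = A - B h^T with h = C g, the matrix determinant lemma gives det (s - D) = det (s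
  - A) (1 + g^T \<chi>(s)) off the spectrum of \<open>A\<close>. Uniqueness of the numerator then
  identifies it with a difference of characteristic polynomials, so the formula also holds at
  eigenvalues of \<open>A\<close>.\<close>

lemma cpoly_numerator:
  fixes A :: "real^'n^'n"
  shows "cpoly (numerator A B C g) s
    = det (mat s - cmat A + outer_product (cvec B) (cvec (C *v g))) - det (mat s - cmat A)"
proof -
  define D where "D = A - outer_product B (C *v g)"
  have D: "mat s - cmat D = mat s - cmat A + outer_product (cvec B) (cvec (C *v g))" for s
    by (simp add: D_def vec_eq_iff outer_product_def cvec_def)
  have "is_numerator A B C g (char_polynomial D - char_polynomial A)"
    unfolding is_numerator_def
  proof (intro allI impI)
    fix s assume nz: "det (mat s - cmat A) \<noteq> 0"
    define S where "S = mat s - cmat A"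
    define R where "R = resolvent_matrix A s"
    have "invertible S"
      using nz by (simp add: S_def invertible_det_nz)
    then have SR: "S ** R = mat 1"
      unfolding R_def resolvent_matrix_def S_def[symmetric] invertible_def matrix_inv_def
      by (rule someI2_ex) simp
    have "S + outer_product (cvec B) (cvec (C *v g))
        = S ** (mat 1 + outer_product (R *v cvec B) (cvec (C *v g)))"
    proof -
      have "S ** outer_product (R *v cvec B) (cvec (C *v g)) = outer_product (S *v (R *v cvec B)) (cvec (C *v g))"
        by (simp add: vec_eq_iff outer_product_def matrix_matrix_mult_def matrix_vector_mult_def sum_distrib_right mult.assoc)
      then show ?thesis
        by (simp add: matrix_add_ldistrib matrix_vector_mul_assoc SR)
    qed
    then have "det (mat s - cmat D) = det S * (1 + scalar_transfer A B C g s)"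
      by (simp add: D S_def[symmetric] det_mul det_mat_1_add_outer_product scalar_transfer_eq R_def)
    then show "scalar_transfer A B C g s
        = cpoly (char_polynomial D - char_polynomial A) s / det (mat s - cmat A)"
      using nz by (simp add: cpoly_diff cpoly_char_polynomial S_def field_simps)
  qed
  then have "numerator A B C g = char_polynomial D - char_polynomial A"
    by (rule numerator_eqI)
  then show ?thesis
    by (simp add: cpoly_diff cpoly_char_polynomial D)
qed

lemma det_closed_loop:
  "det (mat s - cmat A + outer_product (m *s cvec B) (cvec (C *v g)))
     = det (mat s - cmat A) + m * cpoly (numerator A B C g) s"
  unfolding det_add_outer_product cpoly_numerator ..

section \<open>Extending the bound from the imaginary axis to the right half-plane\<close>

lemma cpoly_div_tendsto_0:
  assumes "degree q < degree p \<or> q = 0"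
  shows "((\<lambda>s. cpoly q s / cpoly p s) \<longlongrightarrow> 0) at_infinity"
proof (cases "q = 0")
  case False
  with assms show ?thesis
    unfolding cpoly_def by (intro poly_divide_tendsto_0_at_infinity) (simp add: degree_map_poly)
qed simp

text \<open>The maximum principle for \<open>exp (- H)\<close> on half disks of growing radius.\<close>

lemma Re_ge_on_right_half_plane:
  assumes hol: "H holomorphic_on {s. Re s > 0}" and cont: "continuous_on {s. Re s \<ge> 0} H"
    and lim: "(H \<longlongrightarrow> 0) at_infinity"
    and imag: "\<And>\<omega>. Re (H (\<i> * of_real \<omega>)) \<ge> c" and s: "Re s \<ge> 0"
  shows "Re (H s) \<ge> c"
proof (cases "Re s = 0")
  case True
  then have "s = \<i> * of_real (Im s)" by (simp add: complex_eq_iff)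
  with imag[of "Im s"] show ?thesis by simp
next
  case False
  have "((\<lambda>\<omega>. Re (H (\<i> * of_real \<omega>))) \<longlongrightarrow> Re 0) at_top"
  proof (intro tendsto_Re filterlim_compose[OF lim])
    show "filterlim (\<lambda>\<omega>. \<i> * complex_of_real \<omega>) at_infinity at_top"
      by (rule filterlim_norm_at_top_imp_at_infinity) (simp add: norm_mult filterlim_abs_real)
  qed
  \<comment> \<open>Needed on the arc, where |H| < e only yields Re H > -e, and this is at least c -
    e once c \<le> 0.\<close>
  then have c0: "c \<le> 0"
    using tendsto_lowerbound[of "\<lambda>\<omega>. Re (H (\<i> * of_real \<omega>))" "Re 0" at_top c] imag by simp
  have "Re (H s) \<ge> c - e" if e: "e > 0" for e
  proof -
    obtain b where b: "\<And>x. norm x \<ge> b \<Longrightarrow> norm (H x) < e"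
      using tendstoD[OF lim e] by (auto simp: eventually_at_infinity)
    \<comment> \<open>The bound \<open>b\<close> makes \<open>H\<close> small on the arc;
      \<open>norm s + 1\<close> puts \<open>s\<close> inside the disk.\<close>
    define R where "R = max b (norm s + 1)"
    define S where "S = {s. Re s > 0} \<inter> ball 0 R"
    have S: "open S"
      unfolding S_def using open_halfspace_Re_gt[of 0] by (intro open_Int) auto
    have sub: "closure S \<subseteq> {s. Re s \<ge> 0} \<inter> cball 0 R"
      unfolding S_def by (rule closure_minimal) (auto intro: closed_halfspace_Re_ge)
    have "norm (exp (- H s)) \<le> exp (e - c)"
    proof (rule maximum_modulus_frontier[where S = S and f = "\<lambda>s. exp (- H s)"])
      show "(\<lambda>s. exp (- H s)) holomorphic_on interior S"
        by (intro holomorphic_intros holomorphic_on_subset[OF hol])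
           (use interior_subset[of S] in \<open>auto simp: S_def\<close>)
      show "continuous_on (closure S) (\<lambda>s. exp (- H s))"
        using sub by (intro continuous_intros continuous_on_subset[OF cont]) auto
      show "bounded S" unfolding S_def by (intro bounded_Int) auto
      show "s \<in> S" using s False by (simp add: S_def R_def)
      fix z assume z: "z \<in> frontier S"
      then have z': "z \<in> closure S" "z \<notin> S"
        using S by (auto simp: frontier_def interior_open)
      with sub have "Re z = 0 \<or> norm z = R"
        by (fastforce simp: S_def)
      then have "Re (H z) \<ge> c - e"
      proof
        assume "Re z = 0"
        then have "z = \<i> * of_real (Im z)" by (simp add: complex_eq_iff)
        with imag[of "Im z"] e show ?thesis by simp
      next
        assume "norm z = R"
        with b[of z] c0 abs_Re_le_cmod[of "H z"] show ?thesis
          by (simp add: R_def)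
      qed
      then show "norm (exp (- H z)) \<le> exp (e - c)" by simp
    qed
    then show ?thesis by simp
  qed
  then show ?thesis
    by (metis diff_add_cancel field_le_epsilon add_le_cancel_right diff_le_eq)
qed

text \<open>Division with remainder writes \<alpha> / p as \<rho> + \<kappa> s + H(s), where
  \<kappa> > 0 and \<open>H\<close> vanishes at infinity. On the imaginary axis \<kappa> s has no
  real part, so the definition of \<open>kappa0\<close> bounds Re H from below there. The bound on
  Re H extends to the half-plane, where Re (\<kappa> s) \<ge> 0 can only help.\<close>

lemma Re_minus_reciprocal_transfer_le_kappa0:
  fixes A :: "real^'n^'n"
  assumes hmp: "hyper_minimum_phase A B C g" and s: "Re s \<ge> 0"
  shows "Re (- reciprocal_transfer A B C g s) \<le> kappa0 A B C g"
proof -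
  define p where "p = numerator A B C g"
  define a where "a = char_polynomial A"
  define H where "H s = cpoly (a mod p) s / cpoly p s" for s
  have p: "degree p = CARD('n) - 1" "\<And>m. m \<le> degree p \<Longrightarrow> coeff p m > 0"
    "\<And>s. Re s \<ge> 0 \<Longrightarrow> cpoly p s \<noteq> 0"
    using hmp by (force simp: hyper_minimum_phase_def p_def Let_def)+
  have p0: "p \<noteq> 0" using p(2)[of 0] by auto
  \<comment> \<open>Index types are nonempty, so the subtraction in \<open>CARD('n) - 1\<close> does
    not truncate.\<close>
  have n: "CARD('n) = Suc (degree p)" using p(1) by (simp add: card_gt_0_iff)
  have a: "degree a = Suc (degree p)" "lead_coeff a = 1"
    using char_polynomial_monic[of A] by (simp_all add: a_def n)
  have ap: "a = p * (a div p) + a mod p" by simp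
  have lower: "degree (a mod p) < Suc (degree p)"
    using degree_mod_less[OF p0, of a] by auto
  have "degree (p * (a div p)) = Suc (degree p)"
    using a lower by (metis ap degree_add_eq_left add_diff_cancel_right' degree_add_less linorder_cases less_irrefl lessI degree_add_eq_right)
  then have "degree (a div p) = 1"
    using p0 by (cases "a div p = 0") (auto simp: degree_mult_eq)
  then obtain \<rho> \<kappa> where q: "a div p = [:\<rho>, \<kappa>:]"
    by (metis degree_le_1E order_refl)
  \<comment> \<open>The remainder has too small a degree to contribute, and \<open>a\<close> is
    monic: hence \<kappa> is the inverse of the leading coefficient of \<open>p\<close>.\<close>
  have "coeff a (Suc (degree p)) = coeff p (degree p) * \<kappa>"
    using coeff_mult_degree_sum[of p "a div p"] \<open>degree (a div p) = 1\<close> lower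
    by (subst ap) (simp add: coeff_eq_0 q)
  then have \<kappa>: "\<kappa> > 0"
    using a p(2)[of "degree p"] by (simp add: zero_less_mult_iff) (metis less_numeral_extra(1) mult.commute zero_less_mult_pos2 zero_less_mult_iff)
  have rec: "reciprocal_transfer A B C g s = of_real \<rho> + s * of_real \<kappa> + H s" if "Re s \<ge> 0" for s
  proof -
    have "det (mat s - cmat A) = cpoly (p * (a div p) + a mod p) s"
      by (simp add: cpoly_char_polynomial[symmetric] a_def)
    then show ?thesis
      using p(3)[OF that]
      by (simp add: reciprocal_transfer_def p_def[symmetric] H_def q cpoly_add cpoly_mult cpoly_smult cpoly_pCons field_simps
          del: div_mult_mod_eq mod_mult_div_eq mult_div_mod_eq mod_div_mult_eq)
  qed
  have lim: "(H \<longlongrightarrow> 0) at_infinity"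
    unfolding H_def by (intro cpoly_div_tendsto_0) (use degree_mod_less[OF p0, of a] in auto)
  have cont: "continuous_on {s. Re s \<ge> 0} H"
    unfolding H_def cpoly_def using p(3) by (intro continuous_intros) (auto simp: cpoly_def)
  have hol: "H holomorphic_on {s. Re s > 0}"
    unfolding H_def cpoly_def using p(3) by (intro holomorphic_intros) (auto simp: cpoly_def)
  obtain b where b: "\<And>s. norm s \<ge> b \<Longrightarrow> norm (H s) < 1"
    using tendstoD[OF lim, of 1] by (auto simp: eventually_at_infinity)
  have "compact (H ` ({s. Re s \<ge> 0} \<inter> cball 0 b))"
    by (intro compact_continuous_image continuous_on_subset[OF cont] closed_Int_compact
        closed_halfspace_Re_ge) auto
  then obtain d where d: "\<And>s. Re s \<ge> 0 \<Longrightarrow> norm s \<le> b \<Longrightarrow> norm (H s) \<le> d"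
    by (force dest!: compact_imp_bounded simp: bounded_iff)
  have Hd: "norm (H s) \<le> max d 1" if "Re s \<ge> 0" for s
    using b[of s] d[of s] that by fastforce
  have val: "Re (- reciprocal_transfer A B C g (\<i> * of_real \<omega>)) = - \<rho> - Re (H (\<i> * of_real \<omega>))" for \<omega>
    by (subst rec) auto
  \<comment> \<open>A real supremum dominates its family only if the family is bounded above; this
    follows since \<open>H\<close> is small far out and continuous on the compact rest.\<close>
  have bdd: "bdd_above (range (\<lambda>\<omega>. Re (- reciprocal_transfer A B C g (\<i> * complex_of_real \<omega>))))"
  proof (rule bdd_aboveI2)
    fix \<omega>
    show "Re (- reciprocal_transfer A B C g (\<i> * complex_of_real \<omega>)) \<le> max d 1 - \<rho>"
      unfolding val using Hd[of "\<i> * of_real \<omega>"] abs_Re_le_cmod[of "H (\<i> * of_real \<omega>)"] by simp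
  qed
  have "Re (H (\<i> * of_real \<omega>)) \<ge> - \<rho> - kappa0 A B C g" for \<omega>
    using cSUP_upper[OF UNIV_I bdd, of \<omega>, folded kappa0_def] unfolding val by simp
  from Re_ge_on_right_half_plane[OF hol cont lim this s]
  show ?thesis
    using \<kappa> s by (simp add: rec) (smt (verit) mult_nonneg_nonneg)
qed

section \<open>The matrix exponential\<close>

lemma summable_vec_nth:
  fixes f :: "nat \<Rightarrow> 'a::real_normed_vector^'n"
  shows "summable f \<Longrightarrow> summable (\<lambda>m. f m $ i)"
  by (rule bounded_linear.summable[OF bounded_linear_vec_nth])

lemma suminf_vec_nth:
  fixes f :: "nat \<Rightarrow> 'a::real_normed_vector^'n"
  shows "summable f \<Longrightarrow> suminf f $ i = (\<Sum>m. f m $ i)"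
  by (rule bounded_linear.suminf[OF bounded_linear_vec_nth])

lemma matrix_power_scaleR: "matrix_power (t *\<^sub>R M) m = t ^ m *\<^sub>R matrix_power M m"
proof (induction m)
  case (Suc m)
  have "(t *\<^sub>R M) ** (c *\<^sub>R X) = (t * c) *\<^sub>R (M ** X)" for c X
    by (simp add: vec_eq_iff matrix_matrix_mult_def sum_distrib_left mult_ac)
  with Suc show ?case
    by (simp add: matrix_power_def)
qed (simp add: matrix_power_def)

lemma matrix_power_Suc: "matrix_power M (Suc m) = M ** matrix_power M m"
  by (simp add: matrix_power_def)

lemma matrix_power_Suc_right: "matrix_power M (Suc m) = matrix_power M m ** M"
proof (induction m)
  case 0
  then show ?case by (simp add: matrix_power_def)
next
  case (Suc m)
  then show ?case by (metis matrix_power_Suc matrix_mul_assoc)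
qed

lemma summable_matrix_exp_entry: "summable (\<lambda>m. matrix_power M m $ i $ j / fact m * t ^ m)"
proof -
  have "summable (\<lambda>m. ((1 / fact m) *\<^sub>R matrix_power (t *\<^sub>R M) m) $ i $ j)"
    by (intro summable_vec_nth summable_matrix_exp)
  then show ?thesis by (simp add: matrix_power_scaleR mult_ac)
qed

lemma matrix_exp_entry: "matrix_exp (t *\<^sub>R M) $ i $ j = (\<Sum>m. matrix_power M m $ i $ j / fact m * t ^ m)"
proof -
  have "matrix_exp (t *\<^sub>R M) $ i $ j = (\<Sum>m. ((1 / fact m) *\<^sub>R matrix_power (t *\<^sub>R M) m) $ i $ j)"
    unfolding matrix_exp_def
    by (simp only: suminf_vec_nth[OF summable_matrix_exp] suminf_vec_nth[OF summable_vec_nth[OF summable_matrix_exp]])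
  then show ?thesis by (simp add: matrix_power_scaleR mult_ac)
qed

text \<open>Termwise differentiation of the entry's power series. The factor \<open>M\<close> is
  kept on the right, where it meets z' = A z in \<open>linear_ode_solution\<close>.\<close>

lemma matrix_exp_entry_derivative:
  "((\<lambda>t. matrix_exp (t *\<^sub>R M) $ i $ j) has_real_derivative (matrix_exp (t *\<^sub>R M) ** M) $ i $ j) (at t)"
proof -
  define c where "c m = matrix_power M m $ i $ j / fact m" for m
  have "diffs c m * t ^ m = (\<Sum>l\<in>UNIV. matrix_power M m $ i $ l / fact m * t ^ m * M $ l $ j)" for m
  proof -
    have "diffs c m = matrix_power M (Suc m) $ i $ j / fact m"
      by (simp add: diffs_def c_def del: of_nat_Suc)
    also have "\<dots> = (\<Sum>l\<in>UNIV. matrix_power M m $ i $ l * M $ l $ j) / fact m"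
      by (simp add: matrix_power_Suc_right) (simp add: matrix_matrix_mult_def)
    finally show ?thesis
      by (simp add: sum_divide_distrib sum_distrib_left mult_ac)
  qed
  then have "(\<Sum>m. diffs c m * t ^ m) = (\<Sum>l\<in>UNIV. \<Sum>m. matrix_power M m $ i $ l / fact m * t ^ m * M $ l $ j)"
    by (simp only:) (intro suminf_sum summable_mult2 summable_matrix_exp_entry)
  also have "\<dots> = (matrix_exp (t *\<^sub>R M) ** M) $ i $ j"
    by (simp only: matrix_matrix_mult_def matrix_exp_entry vec_lambda_beta
        suminf_mult2[OF summable_matrix_exp_entry])
  finally have "(matrix_exp (t *\<^sub>R M) ** M) $ i $ j = (\<Sum>m. diffs c m * t ^ m)" ..
  with termdiffs_strong_converges_everywhere[of c t] summable_matrix_exp_entry[of M i j]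
  show ?thesis
    by (simp add: matrix_exp_entry c_def)
qed

lemma matrix_exp_0: "matrix_exp 0 = (mat 1 :: real^'n^'n)"
proof -
  have "matrix_exp (0 *\<^sub>R 0) $ i $ j = (mat 1 :: real^'n^'n) $ i $ j" for i j :: 'n
    unfolding matrix_exp_entry by (subst powser_zero) (simp add: matrix_power_def)
  then show ?thesis by (simp add: vec_eq_iff)
qed

text \<open>The curve \<tau> \<mapsto> exp ((t - \<tau>) A) z(\<tau>) has derivative 0 on [0, t];
  its end values are the two sides.\<close>

lemma linear_ode_solution:
  fixes z :: "real \<Rightarrow> real^'n"
  assumes ode: "\<And>t. t \<ge> 0 \<Longrightarrow> (z has_vector_derivative A *v z t) (at t within {0..})" and t: "t \<ge> 0"
  shows "z t = matrix_exp (t *\<^sub>R A) *v z 0"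
proof -
  have zi: "((\<lambda>\<tau>. z \<tau> $ i) has_real_derivative (A *v z \<tau>) $ i) (at \<tau> within {0..t})" if "\<tau> \<in> {0..t}" for i \<tau>
    unfolding has_real_derivative_iff_has_vector_derivative
    by (rule has_vector_derivative_within_subset[OF bounded_linear.has_vector_derivative[OF bounded_linear_vec_nth ode]])
       (use that in auto)
  have Ei: "((\<lambda>\<tau>. matrix_exp ((t - \<tau>) *\<^sub>R A) $ i $ j) has_real_derivative
      - (matrix_exp ((t - \<tau>) *\<^sub>R A) ** A) $ i $ j) (at \<tau> within {0..t})" for i j \<tau>
  proof -
    have "((\<lambda>\<tau>. t - \<tau>) has_real_derivative - 1) (at \<tau> within {0..t})"
      by (auto intro!: derivative_eq_intros)
    from DERIV_chain2[OF matrix_exp_entry_derivative this, of A i j] show ?thesis by simp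
  qed
  have "(matrix_exp (t *\<^sub>R A) *v z 0) $ i = z t $ i" for i
  proof -
    define \<phi> where "\<phi> \<tau> = (matrix_exp ((t - \<tau>) *\<^sub>R A) *v z \<tau>) $ i" for \<tau>
    have "(\<phi> has_real_derivative 0) (at \<tau> within {0..t})" if "\<tau> \<in> {0..t}" for \<tau>
    proof -
      let ?E = "matrix_exp ((t - \<tau>) *\<^sub>R A)"
      have "(\<phi> has_real_derivative (\<Sum>j\<in>UNIV. - (?E ** A) $ i $ j * z \<tau> $ j + (A *v z \<tau>) $ j * ?E $ i $ j)) (at \<tau> within {0..t})"
        unfolding \<phi>_def matrix_vector_mult_def[of "matrix_exp _"]
        by (simp only: vec_lambda_beta, intro DERIV_sum DERIV_mult Ei zi that)
      moreover have "(\<Sum>j\<in>UNIV. - (?E ** A) $ i $ j * z \<tau> $ j + (A *v z \<tau>) $ j * ?E $ i $ j)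
          = (?E *v (A *v z \<tau>)) $ i - ((?E ** A) *v z \<tau>) $ i"
        by (simp add: matrix_vector_mult_def[of ?E] matrix_vector_mult_def[of "?E ** A"] sum_subtractf mult.commute)
      ultimately show ?thesis
        by (simp add: matrix_vector_mul_assoc)
    qed
    then obtain c where "\<And>\<tau>. \<tau> \<in> {0..t} \<Longrightarrow> \<phi> \<tau> = c"
      using has_field_derivative_zero_constant[of "{0..t}" \<phi>] by auto
    then have "\<phi> 0 = \<phi> t"
      using t by simp
    then show ?thesis
      by (simp add: \<phi>_def matrix_exp_0)
  qed
  then show ?thesis by (simp add: vec_eq_iff)
qed

section \<open>Weighted Laplacians of digraphs with a spanning tree\<close>

lemma weighted_laplace_entry_mult:
  fixes E :: "('N::finite \<times> 'N) set" and w u :: "real^'N"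
  shows "(diag_matrix w ** laplace_matrix E *v u) $ i = w $ i * (\<Sum>j | (i, j) \<in> E. u $ i - u $ j)"
proof -
  have *: "diag_matrix c *v u = (\<chi> i. c $ i * u $ i)" for c u :: "real^'N"
    by (simp add: vec_eq_iff matrix_vector_mult_def diag_matrix_def if_distrib[of "\<lambda>c. c * _"] cong: if_cong)
  have adj: "(adjacency_matrix E *v u) $ i = (\<Sum>j | (i, j) \<in> E. u $ j)" for u :: "real^'N"
    by (simp add: matrix_vector_mult_def adjacency_matrix_def if_distrib[of "\<lambda>c. c * _"] sum.If_cases
        cong: if_cong)
  show ?thesis
    by (simp add: matrix_vector_mul_assoc[symmetric] * laplace_matrix_def matrix_vector_mult_diff_rdistrib
        adj sum_subtractf)
qed

lemma mat_vec_mult: "mat c *v z = c *s z"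
  by (simp add: vec_eq_iff matrix_vector_mult_def mat_def if_distrib[of "\<lambda>c. c * _"] cong: if_cong)

lemma vec_mat_mult: "z v* mat c = c *s (z :: 'a::comm_semiring_1^'n)"
  by (simp add: vec_eq_iff vector_matrix_mult_def mat_def if_distrib[of "\<lambda>c. c * _"] if_distrib[of "\<lambda>c. _ * c"] mult.commute cong: if_cong)

lemma left_kernel_not_invertible:
  fixes S :: "'a::field^'n^'n"
  assumes "z \<noteq> 0" "z v* S = 0"
  shows "\<not> invertible S"
proof
  assume "invertible S"
  then obtain S' where "S ** S' = mat 1"
    by (auto simp: invertible_right_inverse)
  moreover have "(z v* S) v* S' = 0"
    unfolding assms(2) by (simp add: vector_matrix_mult_def vec_eq_iff)
  ultimately show False
    using assms(1) by (simp add: vector_matrix_mul_assoc)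
qed

lemma vector_matrix_mult_diff: "z v* (S - S') = z v* S - z v* (S' :: 'a::comm_ring_1^'n^'m)"
  by (simp add: vec_eq_iff vector_matrix_mult_def sum_subtractf algebra_simps)

lemma vector_diff_matrix_mult: "(z - z') v* S = z v* S - z' v* (S :: 'a::comm_ring_1^'n^'m)"
  by (simp add: vec_eq_iff vector_matrix_mult_def sum_subtractf algebra_simps)

lemma ex_argmax:
  fixes f :: "'N::finite \<Rightarrow> 'b::linorder"
  obtains a where "\<And>j. f j \<le> f a"
proof -
  have "Max (range f) \<in> range f" by (rule Max_in) auto
  then obtain a where "Max (range f) = f a" by (elim rangeE)
  then show thesis using that[of a] by (metis Max_ge finite finite_imageI rangeI)
qed

locale weighted_laplacian =
  fixes E :: "('N::finite \<times> 'N) set" and w :: "real^'N"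
  assumes tree: "has_directed_spanning_tree E" and w_pos: "\<And>i. w $ i > 0"
begin

definition M :: "real^'N^'N" where
  "M = diag_matrix w ** laplace_matrix E"

text \<open>\<open>F\<close> is invertible, and \<open>v\<close> is the unique solution of \<open>F\<^sup>T v = 1\<close>.\<close>

definition F :: "real^'N^'N" where
  "F = M + (\<chi> i j. 1)"

lemma M_nth: "(M *v u) $ i = w $ i * (\<Sum>j | (i, j) \<in> E. u $ i - u $ j)"
  unfolding M_def by (rule weighted_laplace_entry_mult)

lemma M_const: "M *v (\<chi> i. c) = 0"
  by (simp add: vec_eq_iff M_nth)

lemma row_sum_M: "(\<Sum>j\<in>UNIV. M $ i $ j) = 0"
  using arg_cong[OF M_const[of 1], of "\<lambda>v. v $ i"] by (simp add: matrix_vector_mult_def)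

text \<open>At a maximizing vertex the differences to its parents are nonnegative and sum to 0, so
  the maximum passes to every parent and along a path to the root.\<close>

lemma harmonic_max_at_root:
  assumes T: "directed_spanning_tree E T r" and M: "\<And>i. (M *v u) $ i = 0"
  shows "u $ i \<le> u $ r"
proof -
  obtain a where a: "\<And>j. u $ j \<le> u $ a"
    using ex_argmax[of "\<lambda>j. u $ j"] by blast
  have step: "u $ j = u $ a" if "u $ i = u $ a" "(i, j) \<in> E" for i j
  proof -
    have "(\<Sum>j | (i, j) \<in> E. u $ i - u $ j) = 0"
      using M[of i] w_pos[of i] by (simp add: M_nth)
    then have "\<forall>j\<in>{j. (i, j) \<in> E}. u $ i - u $ j = 0"
      by (subst (asm) sum_nonneg_eq_0_iff) (use a that(1) in auto)
    with that show ?thesis by auto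
  qed
  have "(a, r) \<in> T\<^sup>*" "T \<subseteq> E"
    using T by (simp_all add: directed_spanning_tree_def)
  then have "u $ r = u $ a"
    by (induction rule: rtrancl_induct) (use step in blast)+
  with a[of i] show ?thesis by simp
qed

text \<open>At a maximum of \<open>u\<close> the entry of M u is nonnegative; applied to
  \<open>u\<close> and \<open>-u\<close> this forces c = 0, and the maximum principle for both makes
  \<open>u\<close> constant. A constant right-hand side is allowed because F u = 0 arrives in this
  shape.\<close>

lemma M_eq_const_imp:
  assumes "\<And>i. (M *v u) $ i = c"
  shows "c = 0" "u $ i = u $ j"
proof -
  have le: "c \<ge> 0" if "\<And>i. (M *v u) $ i = c" for u c
  proof -
    obtain a where a: "\<And>j. u $ j \<le> u $ a"
      using ex_argmax[of "\<lambda>j. u $ j"] by blast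
    have "w $ a * (\<Sum>j | (a, j) \<in> E. u $ a - u $ j) \<ge> 0"
      using w_pos[of a] a by (intro mult_nonneg_nonneg sum_nonneg) auto
    with that[of a] show ?thesis by (simp add: M_nth)
  qed
  have neg: "(M *v (- u)) $ i = - c" for i
    using assms[of i] by (simp add: vec.neg)
  show c: "c = 0"
    using le[OF assms] le[OF neg] by simp
  obtain T r where T: "directed_spanning_tree E T r"
    using tree by (auto simp: has_directed_spanning_tree_def)
  have "u $ i = u $ r" for i
    using harmonic_max_at_root[OF T, of u i] harmonic_max_at_root[OF T, of "- u" i] assms neg c
    by auto
  then show "u $ i = u $ j" by metis
qed

section \<open>Invertibility of \<open>F\<close> and the normalized left null vector\<close>

lemma F_nth: "(F *v u) $ i = (M *v u) $ i + (\<Sum>j\<in>UNIV. u $ j)"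
  by (simp add: F_def matrix_vector_mult_add_rdistrib) (simp add: matrix_vector_mult_def)

lemma F_ker: "F *v u = 0 \<Longrightarrow> u = 0"
proof -
  assume "F *v u = 0"
  then have M: "(M *v u) $ i = - (\<Sum>j\<in>UNIV. u $ j)" for i
    using F_nth[of u i] by simp
  have "(\<Sum>j\<in>UNIV. u $ j) = 0"
    using M_eq_const_imp(1)[OF M] by simp
  moreover have "(\<Sum>j\<in>UNIV. u $ j) = real CARD('N) * u $ i" for i
  proof -
    have "(\<Sum>j\<in>UNIV. u $ j) = (\<Sum>j\<in>(UNIV :: 'N set). u $ i)"
      by (rule sum.cong[OF refl M_eq_const_imp(2)[OF M]])
    then show ?thesis by simp
  qed
  ultimately show "u = 0"
    by (simp add: vec_eq_iff)
qed

lemma invertible_F: "invertible F"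
  using F_ker by (simp add: invertible_left_inverse matrix_left_invertible_ker)

lemma F_left_ker: "u v* F = 0 \<Longrightarrow> u = 0"
  using left_kernel_not_invertible invertible_F by blast

lemma sum_left_M: "(\<Sum>j\<in>UNIV. (u v* M) $ j) = 0"
proof -
  have "(\<Sum>j\<in>UNIV. (u v* M) $ j) = (\<Sum>i\<in>UNIV. \<Sum>j\<in>UNIV. u $ i * M $ i $ j)"
    unfolding vector_matrix_mult_def by (simp, subst sum.swap) (simp add: mult.commute)
  then show ?thesis
    by (simp add: sum_distrib_left[symmetric] row_sum_M)
qed

lemma left_F: "(u v* F) $ j = (u v* M) $ j + (\<Sum>i\<in>UNIV. u $ i)"
  by (simp add: F_def vector_matrix_mult_def distrib_left distrib_right sum.distrib)

lemma v_of_M: "v_of M v* M = 0" "(\<Sum>i\<in>UNIV. v_of M $ i) = 1"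
proof -
  define P where "P v \<longleftrightarrow> v v* M = 0 \<and> v \<bullet> (\<chi> i. 1) = 1" for v
  have P: "P v \<longleftrightarrow> v v* F = (\<chi> i. 1)" for v
  proof
    assume "P v"
    then show "v v* F = (\<chi> i. 1)"
      by (simp add: P_def vec_eq_iff left_F inner_vec_def)
  next
    assume v: "v v* F = (\<chi> i. 1)"
    \<comment> \<open>Rows of \<open>M\<close> sum to 0, so summing the entries of v^T F leaves only
      the all-ones part.\<close>
    have "(\<Sum>j\<in>UNIV. (v v* F) $ j) = real CARD('N) * (\<Sum>i\<in>UNIV. v $ i)"
      by (simp add: left_F sum.distrib sum_left_M)
    then have "(\<Sum>i\<in>UNIV. v $ i) = 1"
      by (simp add: v)
    with v show "P v"
      by (simp add: P_def vec_eq_iff left_F inner_vec_def)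
  qed
  have "\<exists>v. P v"
    unfolding P using invertible_F
    by (metis invertible_left_inverse vector_matrix_mul_assoc vector_matrix_mul_rid)
  moreover have "v = v'" if "P v" "P v'" for v v'
  proof -
    have "(v - v') v* F = 0"
      using that by (simp add: P vector_diff_matrix_mult)
    from F_left_ker[OF this] show ?thesis by simp
  qed
  ultimately have "\<exists>!v. P v" by blast
  from theI'[OF this] have "P (v_of M)"
    unfolding v_of_def P_def .
  then show "v_of M v* M = 0" "(\<Sum>i\<in>UNIV. v_of M $ i) = 1"
    by (simp_all add: P_def inner_vec_def)
qed

section \<open>Nonzero eigenvalues of the weighted Laplacian\<close>

lemma cmat_M_nth: "(cmat M *v z) $ i = of_real (w $ i) * (\<Sum>j | (i, j) \<in> E. z $ i - z $ j)"
proof -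
  have "Re ((cmat M *v z) $ i) = (M *v (\<chi> j. Re (z $ j))) $ i"
    "Im ((cmat M *v z) $ i) = (M *v (\<chi> j. Im (z $ j))) $ i"
    by (simp_all add: matrix_vector_mult_def)
  then show ?thesis
    by (simp add: complex_eq_iff M_nth)
qed

text \<open>A Gershgorin argument at a component of largest modulus: \<open>l\<close> is a positive
  multiple of a sum of 1 - q_j with q_j in the closed unit disk. The real part is positive unless
  all q_j = 1, which would give l = 0.\<close>

lemma eigenvalue_Re_pos:
  assumes "l \<in> eigenvalues M" "l \<noteq> 0"
  shows "Re l > 0"
proof -
  obtain z where z: "z \<noteq> 0" "cmat M *v z = l *s z"
    using assms(1) by (auto simp: eigenvalues_def)
  obtain i where i: "\<And>j. norm (z $ j) \<le> norm (z $ i)"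
    using ex_argmax[of "\<lambda>j. norm (z $ j)"] by blast
  have zi: "z $ i \<noteq> 0"
    using z(1) i by (metis norm_le_zero_iff norm_zero vec_eq_iff zero_index)
  define q where "q j = z $ j / z $ i" for j
  have q: "norm (q j) \<le> 1" for j
    using i[of j] zi by (simp add: q_def norm_divide)
  have "l * z $ i = of_real (w $ i) * (\<Sum>j | (i, j) \<in> E. z $ i - z $ j)"
    using arg_cong[OF z(2), of "\<lambda>v. v $ i"] by (simp add: cmat_M_nth)
  also have "(\<Sum>j | (i, j) \<in> E. z $ i - z $ j) = (\<Sum>j | (i, j) \<in> E. 1 - q j) * z $ i"
    unfolding sum_distrib_right by (intro sum.cong refl) (simp add: q_def zi field_simps)
  finally have l: "l = of_real (w $ i) * (\<Sum>j | (i, j) \<in> E. 1 - q j)"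
    using zi by simp
  have re: "Re (q j) \<le> 1" for j
    using q[of j] complex_Re_le_cmod[of "q j"] by linarith
  have "\<exists>j. (i, j) \<in> E \<and> Re (q j) < 1"
  proof (rule ccontr)
    assume "\<not> ?thesis"
    with re have "Re (q j) = 1" if "(i, j) \<in> E" for j
      using that by (meson antisym_conv2)
    moreover have "q j = 1" if "Re (q j) = 1" for j
    proof -
      have "(Re (q j))\<^sup>2 + (Im (q j))\<^sup>2 \<le> 1"
        using q[of j] by (simp add: cmod_power2[symmetric] power_le_one)
      with that show ?thesis by (simp add: complex_eq_iff)
    qed
    ultimately have "l = 0"
      unfolding l by (simp add: sum.neutral)
    with assms(2) show False by simp
  qed
  then obtain j where j: "(i, j) \<in> E" "Re (q j) < 1" by blast
  have "(\<Sum>j | (i, j) \<in> E. 1 - Re (q j)) > 0"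
    by (rule sum_pos2[where i = j]) (use j re in auto)
  with w_pos[of i] show ?thesis
    unfolding l by simp
qed

lemma finite_eigenvalues: "finite (eigenvalues M)"
proof (rule finite_subset)
  define P where "P = map_poly complex_of_real (char_polynomial M)"
  show "eigenvalues M \<subseteq> {s. poly P s = 0}"
  proof
    fix s assume "s \<in> eigenvalues M"
    then obtain z where z: "z \<noteq> 0" "cmat M *v z = s *s z"
      by (auto simp: eigenvalues_def)
    have "(mat s - cmat M) *v z = 0"
      using z(2) by (simp add: matrix_vector_mult_diff_rdistrib mat_vec_mult)
    with z(1) have "det (mat s - cmat M) = 0"
      using invertible_det_nz[of "mat s - cmat M"]
      by (auto simp: invertible_left_inverse matrix_left_invertible_ker)
    then show "s \<in> {s. poly P s = 0}"
      by (simp add: P_def cpoly_def[symmetric] cpoly_char_polynomial)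
  qed
  have "char_polynomial M \<noteq> 0"
    using char_polynomial_monic(2)[of M] by auto
  then have "P \<noteq> 0"
    by (simp add: P_def map_poly_eq_0_iff)
  then show "finite {s. poly P s = 0}"
    by (rule poly_roots_finite)
qed

text \<open>The eigenvalue \<open>l\<close> makes the set under \<open>Min\<close> nonempty, and
  \<open>finite_eigenvalues\<close> makes it finite.\<close>

lemma r_of_M:
  assumes "l \<in> eigenvalues M" "l \<noteq> 0"
  shows "0 < r_of M" "r_of M \<le> Re l"
proof -
  have fin: "finite (Re ` (eigenvalues M - {0}))"
    by (simp add: finite_eigenvalues)
  have "r_of M \<in> Re ` (eigenvalues M - {0})"
    unfolding r_of_def using assms by (intro Min_in fin) auto
  then obtain l' where "l' \<in> eigenvalues M" "l' \<noteq> 0" "r_of M = Re l'"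
    by blast
  then show "0 < r_of M"
    using eigenvalue_Re_pos by metis
  show "r_of M \<le> Re l"
    unfolding r_of_def using assms by (intro Min_le fin) auto
qed

text \<open>The left combinations that vanish on consensus states. It contains the image of M^T and
  the vectors e_i - v.\<close>

definition W :: "(complex^'N) set" where
  "W = {a. (\<Sum>i\<in>UNIV. a $ i) = 0}"

lemma subspace_W: "vec.subspace W"
  by (auto simp: W_def vec.subspace_def sum.distrib sum_distrib_left[symmetric])

lemma left_M_W: "a v* cmat M \<in> W"
proof -
  have "(\<Sum>j\<in>UNIV. complex_of_real (M $ i $ j)) = 0" for i
    using row_sum_M[of i] by (simp flip: of_real_sum)
  moreover have "(\<Sum>j\<in>UNIV. (a v* cmat M) $ j) = (\<Sum>i\<in>UNIV. \<Sum>j\<in>UNIV. a $ i * of_real (M $ i $ j))"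
    unfolding vector_matrix_mult_def by (simp, subst sum.swap) (simp add: mult.commute)
  ultimately show ?thesis
    by (simp add: W_def sum_distrib_left[symmetric])
qed

text \<open>On zero-sum vectors a^T M and a^T F agree, and \<open>F\<close> is invertible.\<close>

lemma left_M_ker_W:
  assumes "a \<in> W" "a v* cmat M = 0"
  shows "a = 0"
proof -
  have "(\<chi> i. Re (a $ i)) v* F = 0" "(\<chi> i. Im (a $ i)) v* F = 0"
    using assms
    by (simp_all add: vec_eq_iff left_F W_def complex_eq_iff)
       (simp_all add: vector_matrix_mult_def mult.commute)
  from this[THEN F_left_ker] show ?thesis
    by (simp add: vec_eq_iff complex_eq_iff)
qed

text \<open>\<open>eigenvalues\<close> is defined by right eigenvectors; singularity of M - l passes
  from the left to the right.\<close>

lemma left_eigenvalue_W: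
  assumes "a \<in> W" "a \<noteq> 0" "a v* cmat M = l *s a"
  shows "l \<in> eigenvalues M" "l \<noteq> 0"
proof -
  show "l \<noteq> 0"
    using assms left_M_ker_W by auto
  have "a v* (cmat M - mat l) = 0"
    using assms(3) by (simp add: vector_matrix_mult_diff vec_mat_mult)
  with assms(2) have "\<not> invertible (cmat M - mat l)"
    by (rule left_kernel_not_invertible)
  then obtain z where "z \<noteq> 0" "(cmat M - mat l) *v z = 0"
    by (auto simp: invertible_left_inverse matrix_left_invertible_ker)
  then show "l \<in> eigenvalues M"
    by (auto simp: eigenvalues_def matrix_vector_mult_diff_rdistrib mat_vec_mult)
qed

end

section \<open>Consensus\<close>

text \<open>An eigenvalue \<open>s\<close> is a root of \<alpha> + m p. If Re s \<ge> 0 then p(s)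
  \<noteq> 0 and m = - \<alpha>(s) / p(s), whose real part is at most \<open>kappa0\<close>.\<close>

lemma closed_loop_eigenvalue_Re_neg:
  fixes A :: "real^'n^'n"
  assumes hmp: "hyper_minimum_phase A B C g" and m: "kappa0 A B C g < Re m" and b: "b \<noteq> 0"
    and eig: "b v* (cmat A - outer_product (m *s cvec B) (cvec (C *v g))) = s *s b"
  shows "Re s < 0"
proof (rule ccontr)
  assume "\<not> Re s < 0"
  then have s: "Re s \<ge> 0" by simp
  define D where "D = cmat A - outer_product (m *s cvec B) (cvec (C *v g))"
  have "b v* (mat s - D) = 0"
    using eig by (simp add: D_def[symmetric] vector_matrix_mult_diff vec_mat_mult)
  then have "det (mat s - D) = 0"
    using left_kernel_not_invertible[OF b] by (simp add: invertible_det_nz)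
  moreover have "mat s - D = mat s - cmat A + outer_product (m *s cvec B) (cvec (C *v g))"
    by (simp add: D_def)
  ultimately have 0: "det (mat s - cmat A) + m * cpoly (numerator A B C g) s = 0"
    by (simp add: det_closed_loop)
  have "cpoly (numerator A B C g) s \<noteq> 0"
    using hmp s by (auto simp: hyper_minimum_phase_def Let_def)
  with 0 have "m = - reciprocal_transfer A B C g s"
    by (simp add: reciprocal_transfer_def field_simps add_eq_0_iff)
  with Re_minus_reciprocal_transfer_le_kappa0[OF hmp s] m show False by simp
qed

text \<open>Bilinear, without conjugation, so that matrices move to the other argument as plain
  transposes.\<close>

definition pairing :: "complex^'n \<Rightarrow> real^'n \<Rightarrow> complex" where
  "pairing b v = (\<Sum>m\<in>UNIV. b $ m * of_real (v $ m))"

lemma pairing_diff_left: "pairing (b - b') v = pairing b v - pairing b' v"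
  and pairing_scale_left: "pairing (c *s b) v = c * pairing b v"
  and pairing_add_right: "pairing b (v + v') = pairing b v + pairing b v'"
  and pairing_scaleR_right: "pairing b (r *\<^sub>R v) = of_real r * pairing b v"
  and pairing_cvec: "pairing (cvec h) v = of_real (h \<bullet> v)"
  by (simp_all add: pairing_def cvec_def inner_vec_def algebra_simps sum.distrib sum_subtractf sum_distrib_left)

lemma pairing_vector_matrix_mult: "pairing (b v* cmat A) v = pairing b (A *v v)"
proof -
  have "pairing (b v* cmat A) v = (\<Sum>m\<in>UNIV. \<Sum>i\<in>UNIV. b $ i * of_real (A $ i $ m * v $ m))"
    by (simp add: pairing_def vector_matrix_mult_def sum_distrib_left mult_ac)
  also have "\<dots> = pairing b (A *v v)"
    by (subst sum.swap) (simp add: pairing_def matrix_vector_mult_def sum_distrib_left)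
  finally show ?thesis .
qed

lemma bounded_linear_pairing: "bounded_linear (pairing b)"
  unfolding pairing_def
  by (intro bounded_linear_sum bounded_linear_const_mult bounded_linear_of_real[THEN bounded_linear_compose] bounded_linear_vec_nth)

lemma vector_matrix_mult_outer_product:
  "b v* outer_product (m *s cvec B) h = (m * pairing b B) *s h"
  by (simp add: vec_eq_iff vector_matrix_mult_def outer_product_def pairing_def cvec_def
      sum_distrib_left sum_distrib_right mult_ac)

text \<open>The coordinate of the stacked state along the Kronecker product of \<open>a\<close> and
  \<open>b\<close>.\<close>

definition block_pairing :: "complex^'N \<Rightarrow> complex^'n \<Rightarrow> ('N \<Rightarrow> real^'n) \<Rightarrow> complex" where
  "block_pairing a b X = (\<Sum>i\<in>UNIV. a $ i * pairing b (X i))"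

text \<open>The closed loop with inputs and outputs eliminated: the control of agent
  \<open>i\<close> is -k (M s)_i, where s_j = (C g) \<bullet> x_j.\<close>

locale consensus_network = weighted_laplacian E w
  for E :: "('N::finite \<times> 'N) set" and w :: "real^'N" +
  fixes A :: "real^'n^'n" and B :: "real^'n" and C :: "real^'l^'n" and g :: "real^'l"
    and k :: real and x :: "'N \<Rightarrow> real \<Rightarrow> real^'n"
  assumes hmp: "hyper_minimum_phase A B C g" and k_pos: "k > 0"
    and ode: "\<And>i t. t \<ge> 0 \<Longrightarrow> (x i has_vector_derivative
        A *v x i t - (k * (M *v (\<chi> j. (C *v g) \<bullet> x j t)) $ i) *\<^sub>R B) (at t within {0..})"
    and gain: "k > kappa0 A B C g / r_of M"
begin

abbreviation \<eta> :: "complex^'N \<Rightarrow> complex^'n \<Rightarrow> real \<Rightarrow> complex" where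
  "\<eta> a b t \<equiv> block_pairing a b (\<lambda>i. x i t)"

lemma \<eta>_has_derivative:
  assumes "t \<ge> 0"
  shows "(\<eta> a b has_vector_derivative
    \<eta> a (b v* cmat A) t - of_real k * pairing b B * \<eta> (a v* cmat M) (cvec (C *v g)) t) (at t within {0..})"
proof -
  define s where "s = (\<chi> j. (C *v g) \<bullet> x j t)"
  have "(\<eta> a b has_vector_derivative
      (\<Sum>i\<in>UNIV. a $ i * pairing b (A *v x i t - (k * (M *v s) $ i) *\<^sub>R B))) (at t within {0..})"
    unfolding block_pairing_def s_def
    by (intro has_vector_derivative_sum has_vector_derivative_mult_right
        bounded_linear.has_vector_derivative[OF bounded_linear_pairing] ode assms)
  moreover have "pairing b (A *v x i t - (k * (M *v s) $ i) *\<^sub>R B)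
      = pairing (b v* cmat A) (x i t) - of_real k * pairing b B * of_real ((M *v s) $ i)" for i
    using pairing_add_right[of b "A *v x i t - (k * (M *v s) $ i) *\<^sub>R B" "(k * (M *v s) $ i) *\<^sub>R B"]
    by (simp add: pairing_scaleR_right pairing_vector_matrix_mult)
  moreover have "\<eta> (a v* cmat M) (cvec (C *v g)) t = pairing (a v* cmat M) s"
    by (simp add: block_pairing_def pairing_cvec) (simp add: pairing_def s_def)
  then have "\<eta> (a v* cmat M) (cvec (C *v g)) t = (\<Sum>i\<in>UNIV. a $ i * of_real ((M *v s) $ i))"
    by (simp add: pairing_vector_matrix_mult) (simp add: pairing_def)
  ultimately show ?thesis
    by (simp add: block_pairing_def right_diff_distrib sum_subtractf sum_distrib_left mult_ac)
qed

lemma \<eta>_diff_left: "\<eta> (a - a') b t = \<eta> a b t - \<eta> a' b t"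
  and \<eta>_scale_left: "\<eta> (c *s a) b t = c * \<eta> a b t"
  and \<eta>_diff_right: "\<eta> a (b - b') t = \<eta> a b t - \<eta> a b' t"
  and \<eta>_scale_right: "\<eta> a (c *s b) t = c * \<eta> a b t"
  by (simp_all add: block_pairing_def pairing_diff_left pairing_scale_left algebra_simps
      sum_subtractf sum_distrib_left)

lemma mode_gain:
  assumes "l \<in> eigenvalues M" "l \<noteq> 0"
  shows "kappa0 A B C g < Re (of_real k * l)"
proof -
  have "kappa0 A B C g < k * r_of M"
    using gain r_of_M(1)[OF assms] by (simp add: pos_divide_less_eq)
  also have "\<dots> \<le> k * Re l"
    using r_of_M(2)[OF assms] k_pos by simp
  finally show ?thesis by simp
qed

text \<open>Up to a vanishing term M^T acts on \<open>a\<close> as multiplication by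
  \<open>l\<close>, so the second argument evolves under D = A - k l B h^T. Climbing the generalized
  eigenvectors of D^T leaves one perturbed scalar equation per step, with Re s < 0.\<close>

lemma \<eta>_tendsto_0_mode:
  assumes l: "l \<in> eigenvalues M" "l \<noteq> 0"
    and a: "\<And>b. ((\<eta> (a v* cmat M - l *s a) b) \<longlongrightarrow> 0) at_top"
  shows "((\<eta> a b) \<longlongrightarrow> 0) at_top"
proof -
  define h where "h = cvec (C *v g)"
  define D where "D = cmat A - outer_product ((of_real k * l) *s cvec B) h"
  have D: "b v* D = b v* cmat A - (of_real k * l * pairing b B) *s h" for b
    by (simp add: D_def vector_matrix_mult_diff vector_matrix_mult_outer_product)
  show ?thesis
  proof (rule generalized_eigenvector_induct[where W = UNIV and T = "transpose D" and P = "\<lambda>b. ((\<eta> a b) \<longlongrightarrow> 0) at_top"])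
    show "((\<eta> a 0) \<longlongrightarrow> 0) at_top"
      by (simp add: block_pairing_def pairing_def)
    fix b s z
    assume z: "z \<noteq> 0" "transpose D *v z = s *s z"
      and IH: "((\<eta> a (transpose D *v b - s *s b)) \<longlongrightarrow> 0) at_top"
    \<comment> \<open>Collects all of the derivative except s \<eta>; its first term vanishes at
      infinity by induction on \<open>b\<close>, its second by the assumption on
      \<open>a\<close>.\<close>
    define f where "f t = \<eta> a (b v* D - s *s b) t - of_real k * pairing b B * \<eta> (a v* cmat M - l *s a) h t" for t
    have "(f \<longlongrightarrow> 0 - of_real k * pairing b B * 0) at_top"
      unfolding f_def by (intro tendsto_diff tendsto_mult_left a IH[unfolded transpose_matrix_vector])
    then have f: "(f \<longlongrightarrow> 0) at_top" by simp
    have s: "Re s < 0"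
      using closed_loop_eigenvalue_Re_neg[OF hmp mode_gain[OF l] z(1)] z(2)
      by (simp add: transpose_matrix_vector D_def h_def)
    have "\<eta> a (b v* cmat A) t - of_real k * pairing b B * \<eta> (a v* cmat M) h t = s * \<eta> a b t + f t" for t
      unfolding f_def D \<eta>_diff_left \<eta>_scale_left \<eta>_diff_right \<eta>_scale_right by (simp add: algebra_simps)
    then show "((\<eta> a b) \<longlongrightarrow> 0) at_top"
      using \<eta>_has_derivative[of _ a b] f s
      by (intro scalar_ode_tendsto_0[of "\<eta> a b" s f]) (simp_all add: h_def)
  qed simp_all
qed

text \<open>The outer induction, on \<open>a\<close>. It carries all \<open>b\<close> at once, as
  \<open>\<eta>_tendsto_0_mode\<close> requires; the eigenvector in \<open>W\<close> ensures that
  \<open>s\<close> is a nonzero eigenvalue of \<open>M\<close>.\<close>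

lemma \<eta>_tendsto_0:
  assumes "a \<in> W"
  shows "((\<eta> a b) \<longlongrightarrow> 0) at_top"
proof -
  have "\<forall>b. ((\<eta> a b) \<longlongrightarrow> 0) at_top"
  proof (rule generalized_eigenvector_induct[where W = W and T = "transpose (cmat M)" and P = "\<lambda>a. \<forall>b. ((\<eta> a b) \<longlongrightarrow> 0) at_top"])
    show "\<forall>b. ((\<eta> 0 b) \<longlongrightarrow> 0) at_top"
      by (simp add: block_pairing_def)
    show "transpose (cmat M) *v b \<in> W" for b
      by (simp add: transpose_matrix_vector left_M_W)
    fix b s z
    assume z: "z \<in> W" "z \<noteq> 0" "transpose (cmat M) *v z = s *s z"
      and IH: "\<forall>c. ((\<eta> (transpose (cmat M) *v b - s *s b) c) \<longlongrightarrow> 0) at_top"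
    have "s \<in> eigenvalues M" "s \<noteq> 0"
      using left_eigenvalue_W[of z s] z by (simp_all add: transpose_matrix_vector)
    then show "\<forall>c. ((\<eta> b c) \<longlongrightarrow> 0) at_top"
      using \<eta>_tendsto_0_mode IH[unfolded transpose_matrix_vector] by blast
  qed (fact subspace_W assms)+
  then show ?thesis by blast
qed

text \<open>Since v^T M = 0, the control inputs cancel in the weighted mean.\<close>

lemma weighted_mean_solution:
  assumes "t \<ge> 0"
  shows "(\<Sum>i\<in>UNIV. v_of M $ i *\<^sub>R x i t) = matrix_exp (t *\<^sub>R A) *v (\<Sum>i\<in>UNIV. v_of M $ i *\<^sub>R x i 0)"
proof (rule linear_ode_solution[where z = "\<lambda>t. \<Sum>i\<in>UNIV. v_of M $ i *\<^sub>R x i t", OF _ assms])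
  fix t :: real assume t: "t \<ge> 0"
  define s where "s = (\<chi> j. (C *v g) \<bullet> x j t)"
  have "(\<Sum>i\<in>UNIV. v_of M $ i * (M *v s) $ i) = v_of M \<bullet> (M *v s)"
    by (simp add: inner_vec_def)
  also have "\<dots> = (v_of M v* M) \<bullet> s"
    by (simp add: dot_lmul_matrix)
  finally have 0: "(\<Sum>i\<in>UNIV. v_of M $ i * (M *v s) $ i) = 0"
    by (simp add: v_of_M)
  have "(\<Sum>i\<in>UNIV. v_of M $ i *\<^sub>R (A *v x i t - (k * (M *v s) $ i) *\<^sub>R B))
      = A *v (\<Sum>i\<in>UNIV. v_of M $ i *\<^sub>R x i t) - (k * (\<Sum>i\<in>UNIV. v_of M $ i * (M *v s) $ i)) *\<^sub>R B"
    by (simp add: scaleR_diff_right sum_subtractf vec.sum sum_distrib_left scaleR_left.sum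
        matrix_vector_mult_scaleR linear_sum[OF matrix_vector_mul_linear] mult_ac)
  then have "A *v (\<Sum>i\<in>UNIV. v_of M $ i *\<^sub>R x i t)
      = (\<Sum>i\<in>UNIV. v_of M $ i *\<^sub>R (A *v x i t - (k * (M *v s) $ i) *\<^sub>R B))"
    by (simp add: 0)
  then show "((\<lambda>t. \<Sum>i\<in>UNIV. v_of M $ i *\<^sub>R x i t) has_vector_derivative
      A *v (\<Sum>i\<in>UNIV. v_of M $ i *\<^sub>R x i t)) (at t within {0..})"
    unfolding s_def
    by (simp only:) (intro has_vector_derivative_sum bounded_linear.has_vector_derivative[OF bounded_linear_scaleR_right] ode t)
qed

lemma tendsto_weighted_mean:
  "((\<lambda>t. x i t - matrix_exp (t *\<^sub>R A) *v (\<Sum>j\<in>UNIV. v_of M $ j *\<^sub>R x j 0)) \<longlongrightarrow> 0) at_top"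
proof (rule vec_tendstoI)
  fix m
  \<comment> \<open>With this \<open>a\<close> and b = e_m, \<eta> is component \<open>m\<close> of
    the deviation of x_i from the weighted mean.\<close>
  define a where "a = axis i 1 - cvec (v_of M)"
  have "(\<Sum>j\<in>UNIV. complex_of_real (v_of M $ j)) = 1"
    unfolding of_real_sum[symmetric] v_of_M by simp
  then have "a \<in> W"
    by (simp add: W_def a_def cvec_def sum_subtractf axis_def)
  then have "((\<lambda>t. Re (\<eta> a (axis m 1) t)) \<longlongrightarrow> Re 0) at_top"
    by (intro tendsto_Re \<eta>_tendsto_0)
  moreover have "Re (\<eta> a (axis m 1) t) = (x i t - (\<Sum>j\<in>UNIV. v_of M $ j *\<^sub>R x j t)) $ m" for t
  proof -
    have "pairing (axis m 1) v = of_real (v $ m)" for v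
      by (simp add: pairing_def axis_def if_distrib[of "\<lambda>c. c * _"] cong: if_cong)
    moreover have "(\<Sum>j\<in>UNIV. axis i 1 $ j * complex_of_real (x j t $ m)) = of_real (x i t $ m)"
      by (simp add: axis_def if_distrib[of "\<lambda>c. c * _"] cong: if_cong)
    ultimately show ?thesis
      by (simp add: block_pairing_def a_def cvec_def left_diff_distrib sum_subtractf)
  qed
  ultimately have *: "((\<lambda>t. (x i t - (\<Sum>j\<in>UNIV. v_of M $ j *\<^sub>R x j t)) $ m) \<longlongrightarrow> 0 $ m) at_top"
    by simp
  show "((\<lambda>t. (x i t - matrix_exp (t *\<^sub>R A) *v (\<Sum>j\<in>UNIV. v_of M $ j *\<^sub>R x j 0)) $ m) \<longlongrightarrow> 0 $ m) at_top"
  proof (rule Lim_transform_eventually[OF *])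
    show "\<forall>\<^sub>F t in at_top. (x i t - (\<Sum>j\<in>UNIV. v_of M $ j *\<^sub>R x j t)) $ m
        = (x i t - matrix_exp (t *\<^sub>R A) *v (\<Sum>j\<in>UNIV. v_of M $ j *\<^sub>R x j 0)) $ m"
      using eventually_ge_at_top[of 0] by (rule eventually_mono) (subst weighted_mean_solution, simp_all)
  qed
qed

end

theorem theorem2:
  fixes A :: "real^'n^'n" and B :: "real^'n" and C :: "real^'l^'n" and g :: "real^'l"
    and E :: "('N::finite \<times> 'N) set"
    and k :: real and k' :: "real^'N" and kk :: "'N \<Rightarrow> real"
    and x :: "'N \<Rightarrow> real \<Rightarrow> real^'n"
    and y ybar :: "'N \<Rightarrow> real \<Rightarrow> real^'l"
    and u :: "'N \<Rightarrow> real \<Rightarrow> real"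
    and L K' :: "real^'N^'N"
  assumes "CARD('N) \<ge> 2"
    and "hyper_minimum_phase A B C g"
    and "irrefl E"
    and "has_directed_spanning_tree E"
    and "L = laplace_matrix E"
    and "k > 0"
    and "\<And>i. k' $ i > 0"
    and "\<And>i. kk i = k * k' $ i"
    and "K' = diag_matrix k'"
    and "\<And>i t. t \<ge> 0 \<Longrightarrow>
           (x i has_vector_derivative (A *v x i t + u i t *\<^sub>R B)) (at t within {0..})"
    and "\<And>i t. t \<ge> 0 \<Longrightarrow> y i t = transpose C *v x i t"
    and "\<And>i t. t \<ge> 0 \<Longrightarrow> ybar i t = (\<Sum>j\<in>{j. (i, j) \<in> E}. y i t - y j t)"
    and "\<And>i t. t \<ge> 0 \<Longrightarrow> u i t = - kk i * (g \<bullet> ybar i t)"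
    and "(\<Sum>i\<in>UNIV. (k' $ i)\<^sup>2) = 1"
    and "k > kappa0 A B C g / r_of (K' ** L)"
  shows "(\<forall>i j. ((\<lambda>t. x i t - x j t) \<longlongrightarrow> 0) at_top) \<and>
         (\<forall>i. ((\<lambda>t. x i t - matrix_exp (t *\<^sub>R A) *v
             unblock1 (kronecker (rowvector (v_of (K' ** L))) (mat 1 :: real^'n^'n)
               *v col_stack (\<lambda>j. x j 0))) \<longlongrightarrow> 0) at_top)"
proof -
  interpret weighted_laplacian E k'
    using assms by unfold_locales auto
  have M: "K' ** L = M"
    by (simp add: M_def assms)
  \<comment> \<open>Moving \<open>C\<close> across the inner product turns the output feedback into
    row \<open>i\<close> of \<open>M\<close> applied to the scalars (C g) \<bullet> x_j.\<close>
  have u: "u i t = - (k * (M *v (\<chi> j. (C *v g) \<bullet> x j t)) $ i)" if "t \<ge> 0" for i t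
  proof -
    have "g \<bullet> y j t = (C *v g) \<bullet> x j t" for j
      using assms(11)[OF that]
      by (simp add: transpose_matrix_vector dot_lmul_matrix inner_commute[of g] inner_commute[of "C *v g"])
    then have "g \<bullet> ybar i t = (\<Sum>j | (i, j) \<in> E. (C *v g) \<bullet> x i t - (C *v g) \<bullet> x j t)"
      by (simp add: assms(12)[OF that] inner_sum_right inner_diff_right)
    then show ?thesis
      by (simp add: assms(13)[OF that] assms(8) M_nth mult.assoc)
  qed
  interpret consensus_network E k' A B C g k x
  proof unfold_locales
    fix i and t :: real assume "t \<ge> 0"
    with assms(10)[OF this, of i] u show "(x i has_vector_derivative
        A *v x i t - (k * (M *v (\<chi> j. (C *v g) \<bullet> x j t)) $ i) *\<^sub>R B) (at t within {0..})"
      by simp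
  qed (use assms M in auto)
  let ?c = "\<lambda>t. matrix_exp (t *\<^sub>R A) *v (\<Sum>j\<in>UNIV. v_of M $ j *\<^sub>R x j 0)"
  have "((\<lambda>t. x i t - x j t) \<longlongrightarrow> 0) at_top" for i j
    using tendsto_diff[OF tendsto_weighted_mean[of i] tendsto_weighted_mean[of j]] by simp
  with tendsto_weighted_mean show ?thesis
    by (simp add: M kronecker_rowvector_mult)
qed

end
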